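(* Let $G=(V,\mathcal E,w)$ be an undirected, connected, weighted graph on $n$ nodes with Laplacian $L=\sum_{e\in\mathcal E}w(e)E_eE_e^T$ and largest Laplacian eigenvalue $\lambda_n$. Let $\tau\ge0$ with $\tau\lambda_n<\pi/2$. Consider the consensus network with sensor noise $$\dot x(t)=-L\,x(t-\tau)+L\,\xi(t),\qquad y=M_nx,$$ where $\xi$ is a vector of $n$ mutually independent zero-mean Gaussian white noises of unit intensity. Then for every link $e=\{i,j\}\in\mathcal E$ the sensitivity coefficient is $$\kappa_e=\frac12\,E_e^{T}\big(\tau L+\cos(\tau L)\big)\big(M_n-\sin(\tau L)\big)^{\dagger}E_e .$$
   Context: Notation: - $E_e=e_i-e_j\in\mathbb R^n$, for an arbitrary orientation. - $M_n=I_n-\frac1n\mathbf1\mathbf1^T$. - $X^\dagger$ is the Moore–Penrose pseudo-inverse. - $\cos(X)$ and $\sin(X)$ are the matrix power-series functions. The performance is $$\rho_{ss}(L;\tau)=\lim_{t\to\infty}\mathbb E[y^Ty]=\frac1{2\pi}\int_{-\infty}^\infty\mathrm{Tr}[G(j\omega)^HG(j\omega)]d\omega,\qquad G(s)=M_n(sI+e^{-\tau s}L)^{-1}L.$$ The sensitivity coefficient of link $e$ is $\kappa_e=\partial\rho_{ss}/\partial w(e)$. The input matrix $B=L$ also depends on the weights and is differentiated accordingly. *)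

theory Defs
  imports "HOL-Analysis.Analysis"
begin

text \<open>Nodes are the elements of a finite type 'n (so n = CARD('n)).
  A weighted undirected graph is given by a weight function w on pairs of nodes,
  symmetric, nonnegative, zero on the diagonal; the edges are the pairs with
  positive weight.\<close>

definition is_weighted_graph :: "('n::finite \<Rightarrow> 'n \<Rightarrow> real) \<Rightarrow> bool" where
  "is_weighted_graph w \<longleftrightarrow> (\<forall>i j. w i j = w j i) \<and> (\<forall>i j. 0 \<le> w i j) \<and> (\<forall>i. w i i = 0)"

definition graph_edges :: "('n::finite \<Rightarrow> 'n \<Rightarrow> real) \<Rightarrow> ('n \<times> 'n) set" where
  "graph_edges w = {(i, j). i \<noteq> j \<and> 0 < w i j}"

definition graph_connected :: "('n::finite \<Rightarrow> 'n \<Rightarrow> real) \<Rightarrow> bool" where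
  "graph_connected w \<longleftrightarrow> (\<forall>i j. (i, j) \<in> (graph_edges w)\<^sup>*)"

text \<open>Incidence vector E_e = e_i - e_j.\<close>
definition edge_vec :: "'n::finite \<Rightarrow> 'n \<Rightarrow> real^'n" where
  "edge_vec i j = axis i 1 - axis j 1"

definition outer :: "real^'n \<Rightarrow> real^'m \<Rightarrow> real^'m^'n" where
  "outer u v = (\<chi> a b. u $ a * v $ b)"

text \<open>Laplacian L = sum over edges e of w(e) E_e E_e^T; every undirected edge
  {i,j} appears twice among ordered pairs, hence the factor 1/2.\<close>
definition laplacian :: "('n::finite \<Rightarrow> 'n \<Rightarrow> real) \<Rightarrow> real^'n^'n" where
  "laplacian w = (1/2) *\<^sub>R (\<Sum>(i, j) \<in> graph_edges w. w i j *\<^sub>R outer (edge_vec i j) (edge_vec i j))"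

text \<open>Largest eigenvalue.\<close>
definition max_eigenvalue :: "real^'n^'n \<Rightarrow> real" where
  "max_eigenvalue A = Max {c. \<exists>v. v \<noteq> 0 \<and> A *v v = c *\<^sub>R v}"

text \<open>M_n = I - (1/n) 1 1^T.\<close>
definition centering :: "'a::field^'n::finite^'n" where
  "centering = mat 1 - (\<chi> a b. 1 / of_nat CARD('n))"

primrec mat_pow :: "'a::comm_ring_1^'n::finite^'n \<Rightarrow> nat \<Rightarrow> 'a^'n^'n" where
  "mat_pow A 0 = mat 1"
| "mat_pow A (Suc k) = A ** mat_pow A k"

text \<open>Matrix power-series functions.\<close>
definition mat_cos :: "real^'n::finite^'n \<Rightarrow> real^'n^'n" where
  "mat_cos X = (\<Sum>k. ((-1) ^ k / fact (2 * k)) *\<^sub>R mat_pow X (2 * k))"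

definition mat_sin :: "real^'n::finite^'n \<Rightarrow> real^'n^'n" where
  "mat_sin X = (\<Sum>k. ((-1) ^ k / fact (2 * k + 1)) *\<^sub>R mat_pow X (2 * k + 1))"

text \<open>Moore--Penrose pseudo-inverse (unique matrix satisfying the Penrose equations).\<close>
definition pinv :: "real^'n::finite^'m::finite \<Rightarrow> real^'m^'n" where
  "pinv A = (THE X. A ** X ** A = A \<and> X ** A ** X = X \<and>
                    transpose (A ** X) = A ** X \<and> transpose (X ** A) = X ** A)"

definition cmat :: "real^'n::finite^'m::finite \<Rightarrow> complex^'n^'m" where
  "cmat A = (\<chi> a b. complex_of_real (A $ a $ b))"

definition conj_transpose :: "complex^'n::finite^'m::finite \<Rightarrow> complex^'m^'n" where
  "conj_transpose A = (\<chi> a b. cnj (A $ b $ a))"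

text \<open>Transfer function G(s) = M_n (sI + e^{-tau s} L)^{-1} L (input matrix B = L).\<close>
definition transfer :: "real^'n::finite^'n \<Rightarrow> real \<Rightarrow> complex \<Rightarrow> complex^'n^'n" where
  "transfer L \<tau> s = centering ** matrix_inv (mat s + mat (exp (- complex_of_real \<tau> * s)) ** cmat L) ** cmat L"

text \<open>Steady-state performance (H2-type frequency-domain formula).\<close>
definition rho_ss :: "real^'n::finite^'n \<Rightarrow> real \<Rightarrow> real" where
  "rho_ss L \<tau> = (1 / (2 * pi)) *
     integral UNIV (\<lambda>\<omega>::real. Re (trace (conj_transpose (transfer L \<tau> (\<i> * complex_of_real \<omega>))
                                          ** transfer L \<tau> (\<i> * complex_of_real \<omega>))))"

text \<open>Weight function with the weight of the undirected edge {i,j} set to t.\<close>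
definition set_edge_weight :: "('n \<Rightarrow> 'n \<Rightarrow> real) \<Rightarrow> 'n \<Rightarrow> 'n \<Rightarrow> real \<Rightarrow> 'n \<Rightarrow> 'n \<Rightarrow> real" where
  "set_edge_weight w i j t = (\<lambda>a b. if (a = i \<and> b = j) \<or> (a = j \<and> b = i) then t else w a b)"

text \<open>Sensitivity coefficient kappa_e = d rho_ss / d w(e), as a derivative statement.\<close>

end

theory Submission
  imports Defs "HOL-Complex_Analysis.Cauchy_Integral_Formula"
begin

text \<open>
  In an orthonormal eigenbasis of the Laplacian the transfer function is diagonal, so the
  performance is a sum over the eigenvalues of
  \<open>f x = (1 / 2\<pi>) \<integral> x\<^sup>2 / |\<i>\<omega> + x exp (-\<i>\<tau>\<omega>)|\<^sup>2 d\<omega> = x cos (\<tau>x) / (2 (1 - sin (\<tau>x)))\<close>,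
  where the integral is evaluated by writing the integrand as twice the real part of a function
  that is holomorphic in the right half-plane and behaves like \<open>c / s\<close> at infinity.

  If A and M are symmetric with eigenpairs \<open>(\<alpha>\<^sub>u, u)\<close> and \<open>(\<beta>\<^sub>v, v)\<close>, then
  \<open>tr f(A) - tr f(M) - tr (f'(M) (A - M))\<close> is the sum over all pairs of
  \<open>(f \<alpha>\<^sub>u - f \<beta>\<^sub>v - f' \<beta>\<^sub>v (\<alpha>\<^sub>u - \<beta>\<^sub>v)) (u \<bullet> v)\<^sup>2\<close>,
  which Taylor's theorem bounds by a multiple of the squared Frobenius norm of \<open>A - M\<close>.
  Hence the derivative of \<open>tr f(L)\<close> in the direction \<open>E E\<^sup>T\<close> is \<open>E \<bullet> f'(L) E\<close>,
  without any smoothness of the eigenvectors.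
\<close>

section \<open>The scalar delay integral\<close>

lemma path_image_right_semicircle:
  assumes "0 < R" "z \<in> path_image (part_circlepath 0 R (- pi / 2) (pi / 2))"
  shows "Re z \<ge> 0" "norm z = R"
proof -
  from assms obtain \<theta> where \<theta>: "- pi / 2 \<le> \<theta>" "\<theta> \<le> pi / 2" "z = of_real R * exp (\<i> * of_real \<theta>)"
    by (auto simp: path_image_part_circlepath)
  have "cos \<theta> \<ge> 0" using \<theta> by (intro cos_ge_zero) auto
  thus "Re z \<ge> 0" using \<theta> assms by (simp add: Re_exp)
  show "norm z = R" using \<theta> assms by (simp add: norm_mult)
qed

text \<open>Cauchy's theorem on the right half-disc of radius \<open>R\<close> equates the integral
  along the imaginary axis with the one along the arc, which is at most \<open>K / R^2\<close> times
  the arc length \<open>pi * R\<close>. The convex form of the theorem asks for continuity on the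
  closed half-plane and differentiability only inside it.\<close>

lemma Cauchy_half_plane_tendsto_0:
  fixes F :: "complex \<Rightarrow> complex"
  assumes cont: "continuous_on {s. Re s \<ge> 0} F"
    and hol: "F holomorphic_on {s. Re s > 0}"
    and bound: "\<And>s. Re s \<ge> 0 \<Longrightarrow> norm s \<ge> R0 \<Longrightarrow> norm (F s) \<le> K / norm s ^ 2"
  shows "((\<lambda>R. integral {-R..R} (\<lambda>\<omega>. F (\<i> * of_real \<omega>))) \<longlongrightarrow> 0) at_top"
proof -
  have K: "K \<ge> 0"
  proof -
    have "0 \<le> norm (F (of_real (max R0 1)))" by simp
    also have "\<dots> \<le> K / norm (complex_of_real (max R0 1)) ^ 2" by (rule bound) auto
    finally show ?thesis by (auto simp: field_simps zero_le_divide_iff)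
  qed
  have int_bound: "norm (integral {-R..R} (\<lambda>\<omega>. F (\<i> * of_real \<omega>))) \<le> K * pi / R" if R: "R > 0" "R \<ge> R0" for R
  proof -
    let ?c = "part_circlepath 0 R (- pi / 2) (pi / 2)"
    let ?l = "linepath (- \<i> * of_real R) (\<i> * of_real R)"
    let ?S = "{s. Re s \<ge> 0}"
    have ends: "pathstart ?c = - \<i> * of_real R" "pathfinish ?c = \<i> * of_real R"
      by (simp_all add: exp_Euler cos_of_real sin_of_real flip: of_real_divide of_real_minus) simp
    have cs: "path_image ?c \<subseteq> ?S" using path_image_right_semicircle[OF R(1)] by auto
    have ls: "path_image ?l \<subseteq> ?S"
      by (auto simp: closed_segment_def)
    have int: "interior ?S = {s. Re s > 0}" using interior_halfspace_ge[of "1::complex" 0] by (simp add: inner_complex_def)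
    have ci: "F contour_integrable_on ?c"
      using cont cs by (intro contour_integrable_continuous_part_circlepath continuous_on_subset[OF cont])
    have li: "F contour_integrable_on ?l"
      using cont ls by (intro contour_integrable_continuous_linepath continuous_on_subset[OF cont]) auto
    have "(F has_contour_integral 0) (?c +++ reversepath ?l)"
    proof (rule Cauchy_theorem_convex[where S = ?S and K = "{}"])
      show "convex ?S" by (rule convex_halfspace_Re_ge)
      show "F field_differentiable at x" if "x \<in> interior ?S - {}" for x
        using that int hol by (auto simp: holomorphic_on_open open_halfspace_Re_gt field_differentiable_def)
      show "path_image (?c +++ reversepath ?l) \<subseteq> ?S"
        using cs ls by (intro subset_path_image_join) (simp_all only: path_image_reversepath)
      show "valid_path (?c +++ reversepath ?l)"
        using ends by (intro valid_path_join valid_path_imp_reverse) auto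
    qed (use cont ends in auto)
    moreover have "(F has_contour_integral (contour_integral ?c F - contour_integral ?l F)) (?c +++ reversepath ?l)"
      using has_contour_integral_join[OF has_contour_integral_integral[OF ci]
          has_contour_integral_reversepath[OF _ has_contour_integral_integral[OF li]]] ends
      by auto
    ultimately have eq: "contour_integral ?l F = contour_integral ?c F"
      using has_contour_integral_unique by fastforce
    have "norm (contour_integral ?c F) \<le> K / R^2 * R * (pi / 2 - (- pi / 2))"
      using path_image_right_semicircle[OF R(1)] bound R K
      by (intro has_contour_integral_bound_part_circlepath[OF has_contour_integral_integral[OF ci]]) force+
    also have "\<dots> = K * pi / R" using R by (simp add: field_simps power2_eq_square)
    finally have b: "norm (contour_integral ?l F) \<le> K * pi / R" by (simp only: eq)
    \<comment> \<open>The segment is parametrised by \<open>\<i> * \<omega>\<close>, which costs a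
      factor \<open>\<i>\<close> of modulus 1.\<close>
    have "contour_integral ?l F = \<i> * integral {-R..R} (\<lambda>\<omega>. F (\<i> * of_real \<omega>))"
      using R by (subst contour_integral_linepath_same_Re[where c = 0 and a = "-R" and b = R]) (auto simp: Complex_eq)
    thus ?thesis using b by (simp add: norm_mult)
  qed
  show ?thesis
  proof (rule Lim_null_comparison)
    show "\<forall>\<^sub>F R in at_top. norm (integral {-R..R} (\<lambda>\<omega>. F (\<i> * of_real \<omega>))) \<le> K * pi / R"
      using eventually_gt_at_top[of "max R0 0"] by eventually_elim (auto intro: int_bound)
    show "((\<lambda>R. K * pi / R) \<longlongrightarrow> 0) at_top"
      by (intro tendsto_divide_0[OF tendsto_const] filterlim_at_top_imp_at_infinity filterlim_ident)
  qed
qed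

text \<open>For a nonnegative integrand the truncations to \<open>{-k..k}\<close> increase, so
  monotone convergence upgrades a limit over symmetric intervals to an integral over the whole line.
  The stretch by \<open>m\<close> carries the interval of radius \<open>k / m\<close> to that of
  radius \<open>k\<close>.\<close>

lemma has_integral_UNIV_rescale:
  fixes g :: "real \<Rightarrow> real"
  assumes lim: "((\<lambda>R. integral {-R..R} g) \<longlongrightarrow> l) at_top"
    and cont: "continuous_on UNIV g" and nonneg: "\<And>x. g x \<ge> 0" and m: "m > 0"
  shows "((\<lambda>x. g (x / m)) has_integral m * l) UNIV"
proof (rule has_integral_monotone_convergence_increasing)
  fix k :: nat
  have "(g has_integral integral {- (real k / m)..real k / m} g) {- (real k / m)..real k / m}"
    by (intro integrable_integral integrable_continuous_real continuous_on_subset[OF cont]) auto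
  from has_integral_stretch_real[OF this, of "1/m"] m
  have "((\<lambda>x. g (x / m)) has_integral m * integral {- (real k / m)..real k / m} g) ((\<lambda>x. m * x) ` {- (real k / m)..real k / m})"
    by (simp add: mult.commute)
  moreover have "(\<lambda>x. m * x) ` {- (real k / m)..real k / m} = {- real k..real k}"
    using m by (subst image_mult_atLeastAtMost) auto
  ultimately have "((\<lambda>x. g (x / m)) has_integral m * integral {- (real k / m)..real k / m} g) {-real k..real k}"
    by simp
  thus "((\<lambda>x. if x \<in> {-real k..real k} then g (x / m) else 0) has_integral m * integral {- (real k / m)..real k / m} g) UNIV"
    by (simp only: has_integral_restrict_UNIV)
next
  fix x :: real
  show "(\<lambda>k. if x \<in> {-real k..real k} then g (x / m) else 0) \<longlonglongrightarrow> g (x / m)"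
  proof (rule tendsto_eventually)
    obtain N :: nat where "\<bar>x\<bar> \<le> real N" using real_arch_simple by blast
    thus "\<forall>\<^sub>F k in sequentially. (if x \<in> {-real k..real k} then g (x / m) else 0) = g (x / m)"
      by (intro eventually_sequentiallyI[of N]) (auto simp: abs_le_iff)
  qed
next
  have "filterlim (\<lambda>k::nat. real k / m) at_top sequentially"
    using m by (auto simp: filterlim_real_sequentially divide_inverse intro: filterlim_at_top_mult_tendsto_pos[OF tendsto_const])
  from filterlim_compose[OF lim this]
  show "(\<lambda>k. m * integral {- (real k / m)..real k / m} g) \<longlonglongrightarrow> m * l"
    by (intro tendsto_intros)
qed (use nonneg in auto)

lemma sin_neq_1: "sin x \<noteq> 1" if "0 \<le> x" "x < pi / 2" for x :: real
proof -
  have "sin x < sin (pi / 2)" using that by (intro sin_monotone_2pi) auto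
  thus ?thesis by simp
qed

section \<open>Stability of the delay characteristic function and the normalised integral\<close>

text \<open>A root in the closed right half-plane has modulus at most 1, so \<open>a * Im s\<close>
  lies strictly between -pi/2 and pi/2. Its cosine is then positive, and the real part of the
  equation forces \<open>Re s < 0\<close>.\<close>

lemma delay_char_nonzero:
  assumes a: "0 \<le> a" "a < pi / 2" and s: "Re s \<ge> 0"
  shows "s + exp (- of_real a * s) \<noteq> 0"
proof
  assume "s + exp (- of_real a * s) = 0"
  hence eq: "s = - exp (- of_real a * s)" by (simp add: eq_neg_iff_add_eq_0)
  have "norm s = exp (- a * Re s)" by (subst eq) simp
  also have "\<dots> \<le> 1" using a s by simp
  finally have "\<bar>Im s\<bar> \<le> 1" using abs_Im_le_cmod[of s] by linarith
  hence "\<bar>a * Im s\<bar> \<le> a" using a mult_left_le[of "\<bar>Im s\<bar>" a] by (simp add: abs_mult)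
  hence "cos (a * Im s) > 0" using a by (intro cos_gt_zero_pi) (auto simp: abs_le_iff)
  moreover have "Re s = - exp (- a * Re s) * cos (a * Im s)"
    by (subst eq) (simp add: Re_exp)
  ultimately have "Re s < 0" by (metis exp_gt_zero mult_neg_pos neg_less_0_iff_less)
  thus False using s by simp
qed

text \<open>On the imaginary axis the integrand is \<open>2 * Re F\<close> plus the elementary
  kernel \<open>2 * c / (1 + \<omega>^2)\<close>. \<open>F\<close> is holomorphic in the right
  half-plane and decays like \<open>1 / s^2\<close>, so its integral tends to 0 and the arctangent
  supplies the limit \<open>2 * c * pi\<close>.\<close>

lemma delay_integral_limit:
  fixes a :: real
  assumes a: "0 \<le> a" "a < pi / 2"
  shows "((\<lambda>R. integral {-R..R} (\<lambda>\<omega>. 1 / (1 + \<omega>\<^sup>2 - 2 * \<omega> * sin (a * \<omega>)))) \<longlongrightarrow> pi * (cos a / (1 - sin a))) at_top"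
proof -
  \<comment> \<open>On the imaginary axis the integrand is 1 / (D(s) D(-s)). Seeking A = N / (s^2 + 1) with
    A(s) D(-s) + A(-s) D(s) = 1 forces N = -s q(-s) + q(s) E(s) with q(s) + q(-s) = 1; taking
    q(s) = 1/2 + c s, the value of c is the one for which N vanishes at the poles i and -i.\<close>
  define c where "c = cos a / (1 - sin a) / 2"
  define E where "E = (\<lambda>s. exp (- of_real a * s) :: complex)"
  define D where "D = (\<lambda>s. s + E s)"
  define N where "N = (\<lambda>s. of_real c * s^2 - s / 2 + (1/2 + of_real c * s) * E s)"
  have sin1: "sin a \<noteq> 1" using a by (rule sin_neq_1)
  have D0: "D s \<noteq> 0" if "Re s \<ge> 0" for s
    using delay_char_nonzero[OF a that] by (simp add: D_def E_def)
  have normE: "norm (E s) \<le> 1" if "Re s \<ge> 0" for s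
    using that a by (simp add: E_def)
  have holN: "N holomorphic_on UNIV" unfolding N_def E_def by (intro holomorphic_intros) auto
  \<comment> \<open>\<open>c_eq\<close> and \<open>c_eq'\<close> are the real and the imaginary part
    of \<open>N \<i> = 0\<close>; the same \<open>c\<close> solves both because
    \<open>(1 - sin a) * (1 + sin a)\<close> is the square of \<open>cos a\<close>. The point
    \<open>-\<i>\<close> gives the conjugate equations.\<close>
  have c_eq: "2 * c * (1 - sin a) = cos a" using sin1 by (simp add: c_def field_simps)
  have c_eq': "2 * c * cos a = 1 + sin a"
  proof -
    have "(1 - sin a) * (2 * c * cos a) = (cos a)\<^sup>2" by (simp add: power2_eq_square flip: c_eq)
    also have "\<dots> = (1 - sin a) * (1 + sin a)" by (simp add: cos_squared_eq power2_eq_square algebra_simps)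
    finally show ?thesis using sin1 by simp
  qed
  have "c * sin a = c - cos a / 2" "c * cos a = 1 / 2 + sin a / 2"
    using c_eq by (simp add: algebra_simps) (use c_eq' in linarith)
  hence Ni: "N \<i> = 0" "N (-\<i>) = 0"
    by (auto simp: N_def E_def complex_eq_iff Re_exp Im_exp algebra_simps)
  \<comment> \<open>\<open>A\<close> is the entire extension of \<open>N / (s^2 + 1)\<close>: the
    zeros of \<open>N\<close> at \<open>\<i>\<close> and \<open>-\<i>\<close> make both
    singularities removable, and they are divided out one at a time by difference quotients.\<close>
  obtain A where A: "A holomorphic_on UNIV" "\<And>s. s\<^sup>2 + 1 \<noteq> 0 \<Longrightarrow> A s = N s / (s\<^sup>2 + 1)"
  proof -
    define A1 where "A1 = (\<lambda>z. if z = \<i> then deriv N \<i> else (N z - N \<i>) / (z - \<i>))"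
    define A2 where "A2 = (\<lambda>z. if z = -\<i> then deriv A1 (-\<i>) else (A1 z - A1 (-\<i>)) / (z - (-\<i>)))"
    have "A1 holomorphic_on UNIV" unfolding A1_def by (intro pole_lemma_open holN) auto
    hence "A2 holomorphic_on UNIV" unfolding A2_def by (intro pole_lemma_open) auto
    moreover have "A2 s = N s / (s\<^sup>2 + 1)" if "s\<^sup>2 + 1 \<noteq> 0" for s
    proof -
      have "s\<^sup>2 + 1 = (s - \<i>) * (s + \<i>)" by (simp add: algebra_simps power2_eq_square)
      moreover from this that have "s \<noteq> \<i>" "s \<noteq> -\<i>" by auto
      ultimately show ?thesis using Ni by (simp add: A1_def A2_def)
    qed
    ultimately show ?thesis using that by blast
  qed
  \<comment> \<open>\<open>A\<close> tends to \<open>c\<close> and \<open>D\<close> behaves like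
    \<open>s\<close> at infinity in the half-plane, so \<open>A / D\<close> is asymptotic to
    \<open>c / s\<close>. Subtracting \<open>c / (s + 1)\<close> removes this term, and its pole -1
    lies outside the half-plane.\<close>
  define F where "F = (\<lambda>s. A s / D s - of_real c / (s + 1))"
  have s1: "s + 1 \<noteq> 0" if "Re s \<ge> 0" for s :: complex
    using that by (auto simp: complex_eq_iff)
  have cont: "continuous_on {s. Re s \<ge> 0} F"
    unfolding F_def using D0 s1 unfolding D_def E_def
    by (intro continuous_intros holomorphic_on_imp_continuous_on[OF holomorphic_on_subset[OF A(1)]]) auto
  have hol: "F holomorphic_on {s. Re s > 0}"
    unfolding F_def using D0 s1 unfolding D_def E_def
    by (intro holomorphic_intros holomorphic_on_subset[OF A(1)]) (auto simp: less_imp_le)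
  \<comment> \<open>For \<open>norm s >= 2\<close> the three denominators below are at least 3/4,
    1/2 and 1/2 times their leading powers, whence the factor 16/3; the bracket bounds the numerator
    \<open>P\<close> relative to the square of \<open>norm s\<close>.\<close>
  define K where "K = 16/3 * (\<bar>c - 1/2\<bar> + 3 * \<bar>c\<bar> + 3/2)"
  have bound: "norm (F s) \<le> K / norm s ^ 2" if s: "Re s \<ge> 0" "norm s \<ge> 2" for s
  proof -
    let ?r = "norm s"
    have r: "?r \<ge> 1" "?r \<le> ?r^2" "1 \<le> ?r^2" using s by (auto intro: self_le_power one_le_power)
    have d1: "norm (s\<^sup>2 + 1) \<ge> 3/4 * ?r^2"
    proof -
      have "4 \<le> ?r^2" using s(2) power_mono[of 2 ?r 2] by simp
      moreover have "norm (s\<^sup>2 + 1) \<ge> ?r^2 - 1"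
        using norm_diff_ineq[of "s\<^sup>2" 1] by (simp add: norm_power)
      ultimately show ?thesis by simp
    qed
    have d2: "norm (D s) \<ge> 1/2 * ?r"
      using norm_diff_ineq[of s "E s"] normE[OF s(1)] s(2) by (simp add: D_def)
    have d3: "norm (s + 1) \<ge> 1/2 * ?r"
      using norm_diff_ineq[of s 1] s(2) by simp
    have nz: "s\<^sup>2 + 1 \<noteq> 0" using d1 r by fastforce
    \<comment> \<open>Numerator of \<open>F\<close> over the common denominator. The cubic terms
      cancel, and so does the quadratic part of the coefficient of \<open>E s\<close>, which leaves
      order 2 over order 4.\<close>
    define P where "P = of_real (c - 1/2) * s^2 - of_real (1/2 + c) * s + E s * (s / 2 + 1/2 + of_real c * s - of_real c)"
    have "F s = P / ((s\<^sup>2 + 1) * D s * (s + 1))"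
    proof -
      have "F s = (N s * (s + 1) - of_real c * (s\<^sup>2 + 1) * D s) / ((s\<^sup>2 + 1) * D s * (s + 1))"
      proof -
        have "x / q / d - y / p = (x * p - y * q * d) / (q * d * p)"
          if "q \<noteq> 0" "d \<noteq> 0" "p \<noteq> 0" for x y p q d :: complex
          using that by (simp add: field_simps)
        thus ?thesis using nz D0[OF s(1)] s1[OF s(1)] A(2)[OF nz] by (simp add: F_def)
      qed
      also have "N s * (s + 1) - of_real c * (s\<^sup>2 + 1) * D s = P"
        by (simp add: N_def D_def P_def field_simps power2_eq_square)
      finally show ?thesis .
    qed
    hence "norm (F s) = norm P / (norm (s\<^sup>2 + 1) * norm (D s) * norm (s + 1))"
      by (simp add: norm_divide norm_mult)
    also have "\<dots> \<le> ((\<bar>c - 1/2\<bar> + 3 * \<bar>c\<bar> + 3/2) * ?r^2) / ((3/4 * ?r^2) * (1/2 * ?r) * (1/2 * ?r))"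
    proof (rule frac_le)
      have tri: "norm (x - y + z) \<le> norm x + norm y + norm z" for x y z :: complex by norm
      have tri': "norm (x + y + z - u) \<le> norm x + norm y + norm z + norm u" for x y z u :: complex by norm
      have "norm P \<le> norm (of_real (c - 1/2) * s^2) + norm (of_real (1/2 + c) * s) + norm (E s * (s / 2 + 1/2 + of_real c * s - of_real c))"
        unfolding P_def by (rule tri)
      also have "norm (of_real (c - 1/2) * s^2) = \<bar>c - 1/2\<bar> * ?r^2" by (simp only: norm_mult norm_of_real norm_power)
      also have "norm (of_real (1/2 + c) * s) \<le> (1/2 + \<bar>c\<bar>) * ?r^2"
        unfolding norm_mult norm_of_real using r by (intro mult_mono) auto
      also have "norm (E s * (s / 2 + 1/2 + of_real c * s - of_real c)) \<le> 1 * (norm (s / 2) + norm (1/2 :: complex) + norm (of_real c * s) + norm (of_real c :: complex))"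
        unfolding norm_mult[of "E s"] by (intro mult_mono normE s tri') simp_all
      also have "\<dots> \<le> (1/2 + 1/2 + 2 * \<bar>c\<bar>) * ?r^2"
        using r mult_left_mono[OF r(2), of "\<bar>c\<bar>"] mult_left_mono[OF r(3), of "\<bar>c\<bar>"] 
        by (simp add: norm_mult norm_divide algebra_simps)
      finally show "norm P \<le> (\<bar>c - 1/2\<bar> + 3 * \<bar>c\<bar> + 3/2) * ?r^2" by (simp add: algebra_simps)
      show "3/4 * ?r^2 * (1/2 * ?r) * (1/2 * ?r) \<le> norm (s\<^sup>2 + 1) * norm (D s) * norm (s + 1)"
        using d1 d2 d3 by (intro mult_mono) auto
      show "0 < 3/4 * ?r^2 * (1/2 * ?r) * (1/2 * ?r)" using s(2) by (intro mult_pos_pos) auto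
    qed auto
    also have "\<dots> = K / ?r^2" using r unfolding K_def by (simp add: divide_simps power2_eq_square)
    finally show ?thesis .
  qed
  have lim0: "((\<lambda>R. integral {-R..R} (\<lambda>\<omega>. F (\<i> * of_real \<omega>))) \<longlongrightarrow> 0) at_top"
    by (rule Cauchy_half_plane_tendsto_0[OF cont hol bound])
  have cont_line: "continuous_on S (\<lambda>\<omega>::real. F (\<i> * of_real \<omega>))" for S
    by (rule continuous_on_compose2[OF cont]) (auto intro!: continuous_intros)
  have integrand: "1 / (1 + \<omega>\<^sup>2 - 2 * \<omega> * sin (a * \<omega>)) = 2 * Re (F (\<i> * of_real \<omega>)) + 2 * c * (1 / (1 + \<omega>\<^sup>2))"
    if w: "\<omega>\<^sup>2 \<noteq> 1" for \<omega> :: real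
  proof -
    let ?s = "\<i> * of_real \<omega>"
    have nz: "?s\<^sup>2 + 1 \<noteq> 0" using w by (simp add: power_mult_distrib complex_eq_iff)
    have Ecnj: "cnj (E ?s) = E (- ?s)" by (simp add: E_def exp_cnj)
    have EE: "E ?s * E (- ?s) = 1" by (simp add: E_def exp_minus)
    have Dcnj: "cnj (D ?s) = D (- ?s)" using Ecnj by (simp add: D_def)
    have Ncnj: "cnj (N ?s) = N (- ?s)" using Ecnj by (simp add: N_def)
    have Acnj: "cnj (A ?s) = N (- ?s) / (?s\<^sup>2 + 1)"
      using A(2)[OF nz] Ncnj by simp
    have key: "N ?s * D (- ?s) + N (- ?s) * D ?s = ?s\<^sup>2 + 1"
    proof -
      have "N s * D (- s) + N (- s) * D s = s\<^sup>2 + 1" if "E s * E (-s) = 1" for s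
        using that unfolding N_def D_def by algebra
      thus ?thesis using EE by blast
    qed
    have DD: "D ?s * D (- ?s) = of_real (1 + \<omega>\<^sup>2 - 2 * \<omega> * sin (a * \<omega>))"
      unfolding D_def E_def
      by (auto simp: complex_eq_iff Re_exp Im_exp algebra_simps power2_eq_square)
    have D0': "D ?s \<noteq> 0" "D (- ?s) \<noteq> 0" by (auto intro!: D0)
    have "of_real (2 * Re (A ?s / D ?s)) = A ?s / D ?s + cnj (A ?s / D ?s)"
      by (simp only: complex_add_cnj)
    also have "\<dots> = N ?s / (?s\<^sup>2 + 1) / D ?s + N (- ?s) / (?s\<^sup>2 + 1) / D (- ?s)"
      unfolding complex_cnj_divide Acnj Dcnj by (simp only: A(2)[OF nz])
    also have "\<dots> = (N ?s * D (- ?s) + N (- ?s) * D ?s) / ((?s\<^sup>2 + 1) * (D ?s * D (- ?s)))"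
    proof -
      have "x / q / d + y / q / d' = (x * d' + y * d) / (q * (d * d'))"
        if "q \<noteq> 0" "d \<noteq> 0" "d' \<noteq> 0" for x y q d d' :: complex
        using that by (simp add: field_simps)
      thus ?thesis using nz D0' by blast
    qed
    also have "\<dots> = of_real (1 / (1 + \<omega>\<^sup>2 - 2 * \<omega> * sin (a * \<omega>)))"
      unfolding key DD using nz by simp
    finally have "2 * Re (A ?s / D ?s) = 1 / (1 + \<omega>\<^sup>2 - 2 * \<omega> * sin (a * \<omega>))"
      using of_real_eq_iff by blast
    moreover have "Re (of_real c / (?s + 1)) = c * (1 / (1 + \<omega>\<^sup>2))"
      by (simp add: Re_divide power2_eq_square)
    ultimately show ?thesis by (simp add: F_def)
  qed
  have "integral {-R..R} (\<lambda>\<omega>. 1 / (1 + \<omega>\<^sup>2 - 2 * \<omega> * sin (a * \<omega>)))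
      = 2 * Re (integral {-R..R} (\<lambda>\<omega>. F (\<i> * of_real \<omega>))) + 2 * c * (2 * arctan R)" if R: "R > 0" for R
  proof (rule integral_unique)
    have "((\<lambda>\<omega>. F (\<i> * of_real \<omega>)) has_integral integral {-R..R} (\<lambda>\<omega>. F (\<i> * of_real \<omega>))) {-R..R}"
      by (intro integrable_integral integrable_continuous_real cont_line)
    from has_integral_linear[OF this bounded_linear_Re]
    have 1: "((\<lambda>\<omega>. Re (F (\<i> * of_real \<omega>))) has_integral Re (integral {-R..R} (\<lambda>\<omega>. F (\<i> * of_real \<omega>)))) {-R..R}"
      by (simp add: o_def)
    have 2: "((\<lambda>\<omega>. 1 / (1 + \<omega>\<^sup>2)) has_integral (arctan R - arctan (-R))) {-R..R}"
      using R by (intro fundamental_theorem_of_calculus)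
        (auto intro!: derivative_eq_intros simp: divide_inverse simp flip: has_real_derivative_iff_has_vector_derivative)
    have 3: "((\<lambda>\<omega>. 2 * Re (F (\<i> * of_real \<omega>)) + 2 * c * (1 / (1 + \<omega>\<^sup>2))) has_integral
         (2 * Re (integral {-R..R} (\<lambda>\<omega>. F (\<i> * of_real \<omega>))) + 2 * c * (arctan R - arctan (-R)))) {-R..R}"
      by (intro has_integral_add has_integral_mult_right 1 2)
    show "((\<lambda>\<omega>. 1 / (1 + \<omega>\<^sup>2 - 2 * \<omega> * sin (a * \<omega>))) has_integral
         (2 * Re (integral {-R..R} (\<lambda>\<omega>. F (\<i> * of_real \<omega>))) + 2 * c * (2 * arctan R))) {-R..R}"
      by (rule has_integral_spike[where S = "{-1, 1}", OF _ _ 3[unfolded arctan_minus diff_minus_eq_add mult_2[symmetric]]])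
         (auto simp: integrand power2_eq_1_iff)
  qed
  hence "\<forall>\<^sub>F R in at_top. 2 * Re (integral {-R..R} (\<lambda>\<omega>. F (\<i> * of_real \<omega>))) + 2 * c * (2 * arctan R)
       = integral {-R..R} (\<lambda>\<omega>. 1 / (1 + \<omega>\<^sup>2 - 2 * \<omega> * sin (a * \<omega>)))"
    by (intro eventually_mono[OF eventually_gt_at_top[of 0]]) simp
  moreover have "((\<lambda>R. 2 * Re (integral {-R..R} (\<lambda>\<omega>. F (\<i> * of_real \<omega>))) + 2 * c * (2 * arctan R))
      \<longlongrightarrow> 2 * Re 0 + 2 * c * (2 * (pi / 2))) at_top"
    by (intro tendsto_intros lim0 tendsto_arctan_at_top)
  ultimately have "((\<lambda>R. integral {-R..R} (\<lambda>\<omega>. 1 / (1 + \<omega>\<^sup>2 - 2 * \<omega> * sin (a * \<omega>)))) \<longlongrightarrow> 2 * Re 0 + 2 * c * (2 * (pi / 2))) at_top"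
    by (rule Lim_transform_eventually[rotated])
  moreover have "2 * Re 0 + 2 * c * (2 * (pi / 2)) = pi * (cos a / (1 - sin a))"
  proof -
    have "2 * Re 0 + 2 * (x / 2) * (2 * (pi / 2)) = pi * x" for x by simp
    thus ?thesis by (simp only: c_def)
  qed
  ultimately show ?thesis by simp
qed

section \<open>The delay integral at a positive eigenvalue\<close>

lemma delay_norm_squared:
  "(norm (\<i> * of_real \<omega> + exp (- of_real \<tau> * (\<i> * of_real \<omega>)) * of_real x))\<^sup>2
     = x\<^sup>2 + \<omega>\<^sup>2 - 2 * x * \<omega> * sin (\<tau> * \<omega>)"
proof -
  have "(norm (\<i> * of_real \<omega> + exp (- of_real \<tau> * (\<i> * of_real \<omega>)) * of_real x))\<^sup>2
     = (x * cos (\<tau> * \<omega>))\<^sup>2 + (\<omega> - x * sin (\<tau> * \<omega>))\<^sup>2"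
    by (simp add: cmod_power2 Re_exp Im_exp mult.commute)
  also have "\<dots> = x\<^sup>2 * ((cos (\<tau> * \<omega>))\<^sup>2 + (sin (\<tau> * \<omega>))\<^sup>2) + \<omega>\<^sup>2 - 2 * x * \<omega> * sin (\<tau> * \<omega>)"
    by (simp only: power2_diff power_mult_distrib distrib_left) simp
  finally show ?thesis by simp
qed

lemma delay_denominator_nonzero:
  assumes "0 \<le> \<tau>" "\<tau> * x < pi / 2" "0 < x"
  shows "\<i> * of_real \<omega> + exp (- of_real \<tau> * (\<i> * of_real \<omega>)) * of_real x \<noteq> 0"
proof -
  let ?s = "\<i> * of_real (\<omega> / x)"
  have "?s + exp (- of_real (\<tau> * x) * ?s) \<noteq> 0"
    using assms by (intro delay_char_nonzero) auto
  moreover have "\<i> * of_real \<omega> + exp (- of_real \<tau> * (\<i> * of_real \<omega>)) * of_real x = of_real x * (?s + exp (- of_real (\<tau> * x) * ?s))"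
    using assms(3) by (simp add: algebra_simps)
  ultimately show ?thesis using assms(3) by simp
qed

text \<open>The frequency scaling \<open>\<omega> / x\<close> turns the eigenvalue \<open>x\<close>
  with delay \<tau> into the eigenvalue 1 with delay \<open>\<tau> * x\<close>.\<close>

lemma delay_integral:
  assumes "0 \<le> \<tau>" "\<tau> * x < pi / 2" "0 < x"
  shows "((\<lambda>\<omega>. (norm (of_real x / (\<i> * of_real \<omega> + exp (- of_real \<tau> * (\<i> * of_real \<omega>)) * of_real x)))\<^sup>2)
           has_integral pi * (x * cos (\<tau> * x) / (1 - sin (\<tau> * x)))) UNIV"
proof -
  define g where "g = (\<lambda>\<omega>::real. 1 / (1 + \<omega>\<^sup>2 - 2 * \<omega> * sin (\<tau> * x * \<omega>)))"
  \<comment> \<open>This denominator is the squared modulus of the characteristic function on the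
    axis, for eigenvalue 1 and delay \<open>\<tau> * x\<close>.\<close>
  have den: "1 + \<omega>\<^sup>2 - 2 * \<omega> * sin (\<tau> * x * \<omega>) > 0" for \<omega>
  proof -
    have "(norm (\<i> * of_real \<omega> + exp (- of_real (\<tau> * x) * (\<i> * of_real \<omega>)) * of_real 1))\<^sup>2 > 0"
      using delay_denominator_nonzero[of "\<tau> * x" 1 \<omega>] assms by (simp add: zero_less_power2)
    thus ?thesis unfolding delay_norm_squared by simp
  qed
  have "continuous_on UNIV g" unfolding g_def
    using den by (intro continuous_intros) (auto simp: less_imp_neq[symmetric])
  moreover have "((\<lambda>R. integral {-R..R} g) \<longlongrightarrow> pi * (cos (\<tau> * x) / (1 - sin (\<tau> * x)))) at_top"
    unfolding g_def using assms by (intro delay_integral_limit) auto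
  ultimately have "((\<lambda>\<omega>. g (\<omega> / x)) has_integral x * (pi * (cos (\<tau> * x) / (1 - sin (\<tau> * x))))) UNIV"
    using den assms by (intro has_integral_UNIV_rescale) (auto simp: g_def less_imp_le)
  moreover have "g (\<omega> / x) = (norm (of_real x / (\<i> * of_real \<omega> + exp (- of_real \<tau> * (\<i> * of_real \<omega>)) * of_real x)))\<^sup>2" for \<omega>
  proof -
    have "1 + (\<omega>/x)\<^sup>2 - 2 * (\<omega>/x) * sin (\<tau> * x * (\<omega>/x)) = (x\<^sup>2 + \<omega>\<^sup>2 - 2 * x * \<omega> * sin (\<tau> * \<omega>)) / x\<^sup>2"
      using assms(3) by (simp add: field_simps power2_eq_square)
    thus ?thesis using assms(3) unfolding norm_divide power_divide delay_norm_squared g_def by simp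
  qed
  ultimately show ?thesis by (simp add: mult_ac)
qed

section \<open>Spectral decomposition of symmetric matrices\<close>

lemma quadratic_nonneg_imp_linear_coeff_0:
  fixes b c :: real
  assumes "\<And>t. 0 \<le> 2 * t * b + t\<^sup>2 * c"
  shows "b = 0"
proof (rule ccontr)
  assume b: "b \<noteq> 0"
  \<comment> \<open>Any positive \<open>k\<close> with \<open>c < 2 * k\<close> would do: the test
    point \<open>- b / k\<close> then gives a negative value.\<close>
  define k where "k = \<bar>c\<bar> + 1"
  have k: "k > 0" "c < k" by (auto simp: k_def)
  have "2 * (- b / k) * b + (- b / k)\<^sup>2 * c = b\<^sup>2 / k * (c / k - 2)"
    using k by (simp add: field_simps power2_eq_square)
  moreover have "\<dots> < 0"
    using b k by (intro mult_pos_neg) (auto simp: field_simps)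
  ultimately show False using assms[of "- b / k"] by linarith
qed

text \<open>A maximiser \<open>u\<close> of the quadratic form on the unit sphere of
  \<open>S\<close> is an eigenvector. The residual \<open>r = f u - m u\<close> lies in
  \<open>S\<close> by invariance, and the first variation of the Rayleigh inequality in the
  direction \<open>r\<close> is \<open>- (r \<bullet> r)\<close>, which must vanish.\<close>

lemma self_adjoint_eigenvector_in_subspace:
  fixes f :: "'a::euclidean_space \<Rightarrow> 'a"
  assumes lin: "linear f" and sa: "\<And>x y. f x \<bullet> y = x \<bullet> f y"
    and S: "subspace S" "f ` S \<subseteq> S" "\<exists>x\<in>S. x \<noteq> 0"
  obtains u c where "u \<in> S" "norm u = 1" "f u = c *\<^sub>R u"
proof -
  let ?K = "S \<inter> sphere 0 1"
  have "compact ?K" using S(1) by (intro closed_Int_compact closed_subspace) auto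
  moreover have "?K \<noteq> {}"
  proof -
    obtain x where "x \<in> S" "x \<noteq> 0" using S(3) by blast
    hence "x /\<^sub>R norm x \<in> ?K" using S(1) by (auto simp: subspace_scale)
    thus ?thesis by blast
  qed
  moreover have "continuous_on ?K (\<lambda>x. x \<bullet> f x)"
    using lin by (intro continuous_intros linear_continuous_on) (simp add: linear_conv_bounded_linear)
  ultimately obtain u where u: "u \<in> ?K" "\<And>x. x \<in> ?K \<Longrightarrow> x \<bullet> f x \<le> u \<bullet> f u"
    using continuous_attains_sup[of ?K "\<lambda>x. x \<bullet> f x"] by blast
  define m where "m = u \<bullet> f u"
  have uS: "u \<in> S" and nu: "norm u = 1" using u by auto
  have max: "x \<bullet> f x \<le> m * (x \<bullet> x)" if "x \<in> S" for x
  proof (cases "x = 0")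
    case False
    have "x /\<^sub>R norm x \<in> ?K" using False that S(1) by (auto simp: subspace_scale)
    from u(2)[OF this] have "x \<bullet> f x / (norm x)\<^sup>2 \<le> m"
      using False by (simp add: m_def linear_scale[OF lin] power2_eq_square divide_inverse mult_ac)
    thus ?thesis using False by (simp add: field_simps dot_square_norm)
  qed (simp add: linear_0[OF lin])
  define r where "r = f u - m *\<^sub>R u"
  have rS: "r \<in> S" using uS S unfolding r_def by (intro subspace_diff subspace_scale) auto
  have "m * (u \<bullet> r) - r \<bullet> f u = 0"
  proof (rule quadratic_nonneg_imp_linear_coeff_0[where c = "m * (r \<bullet> r) - r \<bullet> f r"])
    fix t :: real
    have "u + t *\<^sub>R r \<in> S" using uS rS S(1) by (intro subspace_add subspace_scale)
    from max[OF this] have "0 \<le> m * ((u + t *\<^sub>R r) \<bullet> (u + t *\<^sub>R r)) - (u + t *\<^sub>R r) \<bullet> f (u + t *\<^sub>R r)" by simp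
    also have "\<dots> = 2 * t * (m * (u \<bullet> r) - r \<bullet> f u) + t\<^sup>2 * (m * (r \<bullet> r) - r \<bullet> f r)"
    proof -
      have "u \<bullet> u = 1" using nu by (simp add: dot_square_norm)
      moreover have "u \<bullet> f r = r \<bullet> f u" using sa[of u r] by (simp add: inner_commute)
      ultimately show ?thesis
        by (simp add: linear_add[OF lin] linear_scale[OF lin] inner_simps m_def inner_commute[of r u] algebra_simps power2_eq_square)
    qed
    finally show "0 \<le> 2 * t * (m * (u \<bullet> r) - r \<bullet> f u) + t\<^sup>2 * (m * (r \<bullet> r) - r \<bullet> f r)" .
  qed
  moreover have "r \<bullet> r = r \<bullet> f u - m * (u \<bullet> r)"
    using inner_diff_right[of r "f u" "m *\<^sub>R u"] by (simp add: inner_commute flip: r_def)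
  ultimately have "f u = m *\<^sub>R u" by (simp add: r_def)
  thus ?thesis using that uS nu by blast
qed

text \<open>An orthonormal set of eigenvectors of maximal cardinality spans: its orthogonal
  complement is invariant by self-adjointness, and a nonzero complement would supply one more
  eigenvector.\<close>

lemma self_adjoint_orthonormal_eigenbasis:
  fixes f :: "'a::euclidean_space \<Rightarrow> 'a"
  assumes lin: "linear f" and sa: "\<And>x y. f x \<bullet> y = x \<bullet> f y"
  obtains B \<mu> where "finite B" "span B = UNIV" "pairwise orthogonal B"
    "\<And>v. v \<in> B \<Longrightarrow> norm v = 1" "\<And>v. v \<in> B \<Longrightarrow> f v = \<mu> v *\<^sub>R v"
proof -
  define P where "P = (\<lambda>B. finite B \<and> pairwise orthogonal B \<and> (\<forall>v\<in>B. norm v = 1 \<and> (\<exists>c. f v = c *\<^sub>R v)))"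
  have indep: "independent B" if "P B" for B
    using that by (intro pairwise_orthogonal_independent) (auto simp: P_def)
  have "P {}" by (simp add: P_def)
  moreover have "\<forall>B. P B \<longrightarrow> card B \<le> DIM('a)" using indep independent_bound by blast
  ultimately obtain B where B: "P B" and maxB: "\<And>B'. P B' \<Longrightarrow> card B' \<le> card B"
    using ex_has_greatest_nat[of P "{}" card "Suc DIM('a)"] by (auto simp: le_imp_less_Suc)
  define S where "S = {x. \<forall>v\<in>B. v \<bullet> x = 0}"
  have S: "subspace S" by (auto simp: S_def subspace_def inner_simps)
  have "f ` S \<subseteq> S"
  proof safe
    fix x assume "x \<in> S"
    thus "f x \<in> S" using B by (auto simp: S_def P_def sa[symmetric])
  qed
  have S0: "x = 0" if x: "x \<in> S" for x
  proof (rule ccontr)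
    assume "x \<noteq> 0"
    with x obtain u c where u: "u \<in> S" "norm u = 1" "f u = c *\<^sub>R u"
      using self_adjoint_eigenvector_in_subspace[OF lin sa S \<open>f ` S \<subseteq> S\<close>] by blast
    have "u \<notin> B" using u by (auto simp: S_def)
    moreover have "P (insert u B)"
      using B u by (auto simp: P_def S_def pairwise_insert orthogonal_def inner_commute)
    ultimately show False using maxB[of "insert u B"] B by (auto simp: P_def)
  qed
  have "span B = UNIV"
  proof (rule ccontr)
    assume "span B \<noteq> UNIV"
    then obtain a where "a \<noteq> 0" "\<And>x. x \<in> span B \<Longrightarrow> a \<bullet> x = 0"
      using span_not_univ_subset_hyperplane[of B] by auto
    hence "a \<in> S" by (auto simp: S_def inner_commute span_base)
    thus False using S0 \<open>a \<noteq> 0\<close> by blast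
  qed
  moreover obtain \<mu> where "\<And>v. v \<in> B \<Longrightarrow> f v = \<mu> v *\<^sub>R v"
    using B unfolding P_def by metis
  ultimately show ?thesis using that[of B \<mu>] B by (auto simp: P_def)
qed

text \<open>The eigenvalue is attached to the basis vector, so that sums over \<open>B\<close> count
  eigenvalues with multiplicity.\<close>

definition eigenbasis :: "real^'n^'n \<Rightarrow> (real^'n) set \<Rightarrow> (real^'n \<Rightarrow> real) \<Rightarrow> bool" where
  "eigenbasis L B \<mu> \<longleftrightarrow> finite B \<and> span B = UNIV \<and> pairwise orthogonal B \<and>
     (\<forall>v\<in>B. norm v = 1 \<and> L *v v = \<mu> v *\<^sub>R v)"

lemma symmetric_eigenbasis_exists:
  fixes L :: "real^'n^'n"
  assumes "transpose L = L"
  obtains B \<mu> where "eigenbasis L B \<mu>"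
proof -
  have "(L *v x) \<bullet> y = x \<bullet> (L *v y)" for x y
    using dot_lmul_matrix[of x L y] assms by (simp flip: transpose_matrix_vector)
  with self_adjoint_orthonormal_eigenbasis[OF matrix_vector_mul_linear]
  obtain B \<mu> where "finite B" "span B = UNIV" "pairwise orthogonal B"
    "\<And>v. v \<in> B \<Longrightarrow> norm v = 1" "\<And>v. v \<in> B \<Longrightarrow> L *v v = \<mu> v *\<^sub>R v"
    by blast
  thus ?thesis by (intro that[of B \<mu>]) (simp add: eigenbasis_def)
qed

lemma eigenbasis_inner:
  assumes "eigenbasis L B \<mu>" "u \<in> B" "v \<in> B"
  shows "u \<bullet> v = (if u = v then 1 else 0)"
  using assms by (auto simp: eigenbasis_def pairwise_def orthogonal_def dot_square_norm)

lemma eigenbasis_expand: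
  assumes "eigenbasis L B \<mu>"
  shows "(\<Sum>v\<in>B. (x \<bullet> v) *\<^sub>R v) = x"
  using assms by (intro orthonormal_basis_expand) (auto simp: eigenbasis_def)

lemma eigenbasis_parseval:
  assumes "eigenbasis L B \<mu>"
  shows "(\<Sum>v\<in>B. (x \<bullet> v) * (v \<bullet> y)) = x \<bullet> y"
proof -
  have "(\<Sum>v\<in>B. (x \<bullet> v) *\<^sub>R v) \<bullet> y = x \<bullet> y" by (simp only: eigenbasis_expand[OF assms])
  thus ?thesis by (simp add: inner_sum_left)
qed

section \<open>Functional calculus in an eigenbasis\<close>

text \<open>The matrix acting on each basis vector \<open>v\<close> as multiplication by
  \<open>g v\<close>, when \<open>B\<close> is orthonormal. The scalar type is left open so that the
  same calculus serves the real Laplacian and the complex transfer function.\<close>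

definition spec_mat :: "(real^'n::finite) set \<Rightarrow> (real^'n \<Rightarrow> 'a::real_field) \<Rightarrow> 'a^'n^'n" where
  "spec_mat B g = (\<chi> a b. \<Sum>v\<in>B. g v * of_real (v $ a * v $ b))"

lemma spec_mat_cong: "(\<And>v. v \<in> B \<Longrightarrow> g v = h v) \<Longrightarrow> spec_mat B g = spec_mat B h"
  by (simp add: spec_mat_def)

lemma spec_mat_add: "spec_mat B (\<lambda>v. g v + h v) = spec_mat B g + spec_mat B h"
  by (simp add: spec_mat_def vec_eq_iff sum.distrib distrib_right)

lemma spec_mat_diff: "spec_mat B (\<lambda>v. g v - h v) = spec_mat B g - spec_mat B h"
  by (simp add: spec_mat_def vec_eq_iff sum_subtractf left_diff_distrib)

lemma spec_mat_scaleR: "spec_mat B (\<lambda>v. c * g v) = c *\<^sub>R spec_mat B (g :: _ \<Rightarrow> real)"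
  by (simp add: spec_mat_def vec_eq_iff sum_distrib_left mult_ac)

lemma transpose_spec_mat: "transpose (spec_mat B g) = spec_mat B g"
  by (simp add: spec_mat_def transpose_def vec_eq_iff mult.commute)

lemma spec_mat_1:
  fixes L :: "real^'n::finite^'n"
  assumes "eigenbasis L B \<mu>"
  shows "spec_mat B (\<lambda>_. 1 :: 'a::real_field) = mat 1"
proof -
  have "(\<Sum>v\<in>B. v $ a * v $ b) = (if a = b then 1 else 0)" for a b
    using eigenbasis_parseval[OF assms, of "axis a 1" "axis b 1"]
    by (simp add: inner_axis inner_axis') (simp add: axis_def)
  hence "(\<Sum>v\<in>B. of_real (v $ a * v $ b)) = (if a = b then 1 else 0 :: 'a)" for a b
    by (metis (no_types) of_real_0 of_real_1 of_real_sum)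
  thus ?thesis by (simp add: spec_mat_def mat_def vec_eq_iff)
qed

text \<open>Summing over the inner index yields the inner products \<open>v \<bullet> u\<close>, and
  orthonormality leaves only the diagonal terms.\<close>

lemma spec_mat_mult:
  assumes "eigenbasis L B \<mu>"
  shows "spec_mat B g ** spec_mat B h = spec_mat B (\<lambda>v. g v * h v)"
proof -
  have fin: "finite B" using assms by (simp add: eigenbasis_def)
  have "(\<Sum>k\<in>UNIV. (\<Sum>v\<in>B. g v * of_real (v $ a * v $ k)) * (\<Sum>u\<in>B. h u * of_real (u $ k * u $ b)))
      = (\<Sum>v\<in>B. g v * h v * of_real (v $ a * v $ b))" for a b
  proof -
    have "(\<Sum>k\<in>UNIV. (\<Sum>v\<in>B. g v * of_real (v $ a * v $ k)) * (\<Sum>u\<in>B. h u * of_real (u $ k * u $ b)))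
       = (\<Sum>k\<in>UNIV. \<Sum>v\<in>B. \<Sum>u\<in>B. g v * h u * of_real (v $ a * u $ b) * of_real (v $ k * u $ k))"
      by (simp add: sum_product mult_ac)
    also have "\<dots> = (\<Sum>v\<in>B. \<Sum>u\<in>B. \<Sum>k\<in>UNIV. g v * h u * of_real (v $ a * u $ b) * of_real (v $ k * u $ k))"
      by (subst sum.swap, rule sum.cong[OF refl], subst sum.swap) simp
    also have "\<dots> = (\<Sum>v\<in>B. \<Sum>u\<in>B. g v * h u * of_real (v $ a * u $ b) * of_real (v \<bullet> u))"
      by (simp only: inner_vec_def inner_real_def of_real_sum sum_distrib_left)
    also have "\<dots> = (\<Sum>v\<in>B. \<Sum>u\<in>B. if v = u then g v * h u * of_real (v $ a * u $ b) else 0)"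
      by (intro sum.cong refl) (simp add: eigenbasis_inner[OF assms])
    finally show ?thesis using fin by simp
  qed
  thus ?thesis by (simp add: spec_mat_def matrix_matrix_mult_def vec_eq_iff)
qed

lemma spec_mat_mult_vec:
  fixes g :: "_ \<Rightarrow> real"
  shows "spec_mat B g *v x = (\<Sum>v\<in>B. (g v * (v \<bullet> x)) *\<^sub>R v)"
  by (simp add: spec_mat_def matrix_vector_mult_def vec_eq_iff inner_vec_def sum_distrib_left sum_distrib_right mult_ac)
     (subst sum.swap, simp)

lemma spec_mat_eigenvalue:
  assumes "eigenbasis L B \<mu>"
  shows "spec_mat B \<mu> = L"
proof (rule matrix_eq[THEN iffD2, rule_format])
  fix x
  have "L *v x = L *v (\<Sum>v\<in>B. (x \<bullet> v) *\<^sub>R v)" by (simp only: eigenbasis_expand[OF assms])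
  also have "\<dots> = (\<Sum>v\<in>B. (x \<bullet> v) *\<^sub>R (L *v v))"
    by (simp add: linear_sum[OF matrix_vector_mul_linear] matrix_vector_mult_scaleR)
  also have "\<dots> = (\<Sum>v\<in>B. (\<mu> v * (v \<bullet> x)) *\<^sub>R v)"
    using assms by (intro sum.cong) (auto simp: eigenbasis_def inner_commute)
  finally show "spec_mat B \<mu> *v x = L *v x" by (simp add: spec_mat_mult_vec)
qed

lemma cmat_spec_mat: "cmat (spec_mat B g) = spec_mat B (\<lambda>v. complex_of_real (g v))"
  by (simp add: cmat_def spec_mat_def vec_eq_iff)

lemma mat_mult_spec_mat:
  fixes g :: "real^'b::finite \<Rightarrow> 'a::real_field"
  shows "mat c ** spec_mat B g = spec_mat B (\<lambda>v. c * g v)"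
proof -
  have "(\<Sum>k\<in>UNIV. (if a = k then c else 0) * x k) = c * x a" for a and x :: "'b \<Rightarrow> 'a"
    by (simp add: if_distrib[where f = "\<lambda>y. y * _"] cong: if_cong)
  thus ?thesis by (simp add: spec_mat_def matrix_matrix_mult_def mat_def vec_eq_iff)
    (simp add: sum_distrib_left mult.assoc)
qed

lemma mat_eq_spec_mat:
  assumes "eigenbasis L B \<mu>"
  shows "mat c = spec_mat B (\<lambda>_. c)"
proof -
  have "mat c = mat c ** spec_mat B (\<lambda>_. 1)" by (simp only: spec_mat_1[OF assms] matrix_mul_rid)
  thus ?thesis by (simp add: mat_mult_spec_mat)
qed

text \<open>\<open>matrix_inv\<close> is a choice among two-sided inverses; for square matrices over
  a field a right inverse is two-sided, hence the only candidate.\<close>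

lemma matrix_inv_eqI:
  fixes A X :: "'a::field^'n^'n"
  assumes "A ** X = mat 1"
  shows "matrix_inv A = X"
proof -
  have XA: "X ** A = mat 1" using assms matrix_left_right_inverse by blast
  have "A ** matrix_inv A = mat 1 \<and> matrix_inv A ** A = mat 1"
    unfolding matrix_inv_def by (rule someI[of _ X]) (simp add: assms XA)
  hence "X ** (A ** matrix_inv A) = X" by simp
  thus ?thesis by (simp add: matrix_mul_assoc XA)
qed

text \<open>The squared Frobenius norm is the sum of squared moduli of the spectral values, because
  each \<open>v v^T\<close> has trace \<open>v \<bullet> v = 1\<close>.\<close>

lemma trace_conj_transpose_spec_mat:
  assumes "eigenbasis L B \<mu>"
  shows "trace (conj_transpose (spec_mat B g) ** spec_mat B g) = of_real (\<Sum>v\<in>B. (norm (g v))\<^sup>2)"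
proof -
  have "conj_transpose (spec_mat B g) = spec_mat B (\<lambda>v. cnj (g v))"
    by (simp add: conj_transpose_def spec_mat_def vec_eq_iff mult.commute)
  hence "trace (conj_transpose (spec_mat B g) ** spec_mat B g) = trace (spec_mat B (\<lambda>v. cnj (g v) * g v))"
    by (simp add: spec_mat_mult[OF assms])
  also have "\<dots> = (\<Sum>v\<in>B. \<Sum>a\<in>UNIV. cnj (g v) * g v * of_real (v $ a * v $ a))"
    unfolding trace_def spec_mat_def by (subst sum.swap) simp
  also have "\<dots> = (\<Sum>v\<in>B. cnj (g v) * g v * of_real (v \<bullet> v))"
    by (simp only: inner_vec_def inner_real_def of_real_sum sum_distrib_left)
  also have "\<dots> = (\<Sum>v\<in>B. of_real ((norm (g v))\<^sup>2))"
    by (intro sum.cong refl) (simp only: eigenbasis_inner[OF assms] complex_norm_square mult.commute[of "cnj _"] simp_thms if_True of_real_1 mult_1_right)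
  finally show ?thesis by simp
qed

section \<open>Quadratic forms and the largest eigenvalue\<close>

lemma eigenbasis_transpose:
  assumes "eigenbasis L B \<mu>" shows "transpose L = L"
  using transpose_spec_mat[of B \<mu>] spec_mat_eigenvalue[OF assms] by simp

lemma eigenbasis_inner_mult:
  assumes "eigenbasis L B \<mu>" "v \<in> B"
  shows "v \<bullet> (L *v x) = \<mu> v * (v \<bullet> x)"
proof -
  have "v \<bullet> (L *v x) = (L *v v) \<bullet> x"
    using dot_lmul_matrix[of v L x] eigenbasis_transpose[OF assms(1)] by (simp flip: transpose_matrix_vector)
  also have "L *v v = \<mu> v *\<^sub>R v" using assms by (simp add: eigenbasis_def)
  finally show ?thesis by simp
qed

lemma eigenbasis_quadratic_form:
  assumes "eigenbasis L B \<mu>"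
  shows "x \<bullet> (L *v x) = (\<Sum>v\<in>B. \<mu> v * (v \<bullet> x)\<^sup>2)"
proof -
  have "x \<bullet> (L *v x) = (\<Sum>v\<in>B. (x \<bullet> v) * (v \<bullet> (L *v x)))"
    by (simp only: eigenbasis_parseval[OF assms])
  also have "\<dots> = (\<Sum>v\<in>B. \<mu> v * (v \<bullet> x)\<^sup>2)"
    by (intro sum.cong refl) (simp add: eigenbasis_inner_mult[OF assms] inner_commute power2_eq_square)
  finally show ?thesis .
qed

lemma eigenbasis_norm_squared:
  assumes "eigenbasis L B \<mu>"
  shows "(\<Sum>v\<in>B. (v \<bullet> x)\<^sup>2) = (norm x)\<^sup>2"
  using eigenbasis_parseval[OF assms, of x x] by (simp add: inner_commute power2_eq_square dot_square_norm)

lemma eigenbasis_eigenvalue: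
  assumes "eigenbasis L B \<mu>" "v \<in> B"
  shows "v \<bullet> (L *v v) = \<mu> v"
  using eigenbasis_inner_mult[OF assms] eigenbasis_inner[OF assms assms(2)] by simp

text \<open>An eigenvector has a nonzero component along some basis vector, and comparing that
  component on both sides identifies its eigenvalue with one of the \<mu> values. This makes the
  \<open>Max\<close> in \<open>max_eigenvalue\<close> a genuine upper bound.\<close>

lemma finite_eigenvalues:
  assumes "eigenbasis L B \<mu>"
  shows "finite {c. \<exists>x. x \<noteq> 0 \<and> L *v x = c *\<^sub>R x}"
proof (rule finite_subset)
  show "{c. \<exists>x. x \<noteq> 0 \<and> L *v x = c *\<^sub>R x} \<subseteq> \<mu> ` B"
  proof clarify
    fix c x assume x: "x \<noteq> 0" "L *v x = c *\<^sub>R x"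
    have "(\<Sum>v\<in>B. (v \<bullet> x)\<^sup>2) \<noteq> 0"
      using eigenbasis_norm_squared[OF assms, of x] x(1) by simp
    then obtain v where "v \<in> B" "(v \<bullet> x)\<^sup>2 \<noteq> 0" by (rule sum.not_neutral_contains_not_neutral)
    hence v: "v \<in> B" "v \<bullet> x \<noteq> 0" by auto
    have "c = \<mu> v" using eigenbasis_inner_mult[OF assms v(1), of x] x v by simp
    thus "c \<in> \<mu> ` B" using v by blast
  qed
  show "finite (\<mu> ` B)" using assms by (simp add: eigenbasis_def)
qed

lemma eigenvalue_le_max:
  assumes "eigenbasis L B \<mu>" "v \<in> B"
  shows "\<mu> v \<le> max_eigenvalue L"
proof -
  have "v \<noteq> 0" "L *v v = \<mu> v *\<^sub>R v" using assms by (auto simp: eigenbasis_def)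
  thus ?thesis unfolding max_eigenvalue_def using finite_eigenvalues[OF assms(1)] by (intro Max_ge) auto
qed

lemma quadratic_form_le_max_eigenvalue:
  assumes "transpose L = L"
  shows "x \<bullet> (L *v x) \<le> max_eigenvalue L * (norm x)\<^sup>2"
proof -
  obtain B \<mu> where B: "eigenbasis L B \<mu>" using symmetric_eigenbasis_exists[OF assms] .
  have "x \<bullet> (L *v x) \<le> (\<Sum>v\<in>B. max_eigenvalue L * (v \<bullet> x)\<^sup>2)"
    unfolding eigenbasis_quadratic_form[OF B] using eigenvalue_le_max[OF B] by (intro sum_mono mult_right_mono) auto
  also have "\<dots> = max_eigenvalue L * (norm x)\<^sup>2"
    by (simp add: eigenbasis_norm_squared[OF B] flip: sum_distrib_left)
  finally show ?thesis .
qed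

section \<open>First-order comparison of spectral sums\<close>

text \<open>The weights \<open>(u \<bullet> v)^2\<close> sum to 1 over either basis, and \<open>u
  \<bullet> ((A - M) v) = (\<alpha> u - \<beta> v) * (u \<bullet> v)\<close>. All the sums thus
  become double sums with the same weights and can be compared term by term through the scalar
  bound.\<close>

lemma spectral_sum_first_order:
  fixes A M :: "real^'n::finite^'n" and f f' :: "real \<Rightarrow> real"
  assumes U: "eigenbasis A U \<alpha>" and V: "eigenbasis M V \<beta>"
    and bound: "\<And>u v. u \<in> U \<Longrightarrow> v \<in> V \<Longrightarrow>
      \<bar>f (\<alpha> u) - f (\<beta> v) - f' (\<beta> v) * (\<alpha> u - \<beta> v)\<bar> \<le> C * (\<alpha> u - \<beta> v)\<^sup>2"
  shows "\<bar>(\<Sum>u\<in>U. f (\<alpha> u)) - (\<Sum>v\<in>V. f (\<beta> v)) - (\<Sum>v\<in>V. f' (\<beta> v) * (v \<bullet> ((A - M) *v v)))\<bar>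
     \<le> C * (\<Sum>v\<in>V. (norm ((A - M) *v v))\<^sup>2)"
proof -
  have nU: "norm u = 1" if "u \<in> U" for u using U that by (simp add: eigenbasis_def)
  have nV: "norm v = 1" if "v \<in> V" for v using V that by (simp add: eigenbasis_def)
  have diff: "u \<bullet> ((A - M) *v v) = (\<alpha> u - \<beta> v) * (u \<bullet> v)" if "u \<in> U" "v \<in> V" for u v
  proof -
    have "M *v v = \<beta> v *\<^sub>R v" using V that by (simp add: eigenbasis_def)
    thus ?thesis using eigenbasis_inner_mult[OF U that(1)]
      by (simp add: matrix_vector_mult_diff_rdistrib inner_simps left_diff_distrib)
  qed
  have 1: "(\<Sum>u\<in>U. f (\<alpha> u)) = (\<Sum>v\<in>V. \<Sum>u\<in>U. f (\<alpha> u) * (u \<bullet> v)\<^sup>2)"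
  proof -
    have "(\<Sum>u\<in>U. f (\<alpha> u)) = (\<Sum>u\<in>U. f (\<alpha> u) * (\<Sum>v\<in>V. (v \<bullet> u)\<^sup>2))"
      by (simp add: eigenbasis_norm_squared[OF V] nU)
    also have "\<dots> = (\<Sum>u\<in>U. \<Sum>v\<in>V. f (\<alpha> u) * (u \<bullet> v)\<^sup>2)"
      by (simp add: sum_distrib_left inner_commute)
    finally show ?thesis by (subst sum.swap)
  qed
  have 2: "(\<Sum>v\<in>V. f (\<beta> v)) = (\<Sum>v\<in>V. \<Sum>u\<in>U. f (\<beta> v) * (u \<bullet> v)\<^sup>2)"
    by (simp add: eigenbasis_norm_squared[OF U] nV flip: sum_distrib_left)
  have 3: "(\<Sum>v\<in>V. f' (\<beta> v) * (v \<bullet> ((A - M) *v v))) = (\<Sum>v\<in>V. \<Sum>u\<in>U. f' (\<beta> v) * (\<alpha> u - \<beta> v) * (u \<bullet> v)\<^sup>2)"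
  proof (intro sum.cong refl)
    fix v assume v: "v \<in> V"
    have "v \<bullet> ((A - M) *v v) = (\<Sum>u\<in>U. (v \<bullet> u) * (u \<bullet> ((A - M) *v v)))"
      by (simp only: eigenbasis_parseval[OF U])
    also have "\<dots> = (\<Sum>u\<in>U. (\<alpha> u - \<beta> v) * (u \<bullet> v)\<^sup>2)"
      by (intro sum.cong refl) (simp add: diff v inner_commute power2_eq_square)
    finally show "f' (\<beta> v) * (v \<bullet> ((A - M) *v v)) = (\<Sum>u\<in>U. f' (\<beta> v) * (\<alpha> u - \<beta> v) * (u \<bullet> v)\<^sup>2)"
      by (simp add: sum_distrib_left mult.assoc)
  qed
  have 4: "(norm ((A - M) *v v))\<^sup>2 = (\<Sum>u\<in>U. (\<alpha> u - \<beta> v)\<^sup>2 * (u \<bullet> v)\<^sup>2)" if "v \<in> V" for v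
    unfolding eigenbasis_norm_squared[OF U, symmetric]
    by (intro sum.cong refl) (simp add: diff that power_mult_distrib)
  have "\<bar>(\<Sum>u\<in>U. f (\<alpha> u)) - (\<Sum>v\<in>V. f (\<beta> v)) - (\<Sum>v\<in>V. f' (\<beta> v) * (v \<bullet> ((A - M) *v v)))\<bar>
     = \<bar>\<Sum>v\<in>V. \<Sum>u\<in>U. (f (\<alpha> u) - f (\<beta> v) - f' (\<beta> v) * (\<alpha> u - \<beta> v)) * (u \<bullet> v)\<^sup>2\<bar>"
    unfolding 1 2 3 by (simp add: left_diff_distrib flip: sum_subtractf)
  also have "\<dots> \<le> (\<Sum>v\<in>V. \<Sum>u\<in>U. \<bar>(f (\<alpha> u) - f (\<beta> v) - f' (\<beta> v) * (\<alpha> u - \<beta> v)) * (u \<bullet> v)\<^sup>2\<bar>)"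
    by (rule order_trans[OF sum_abs sum_mono[OF sum_abs]])
  also have "\<dots> \<le> (\<Sum>v\<in>V. \<Sum>u\<in>U. C * (\<alpha> u - \<beta> v)\<^sup>2 * (u \<bullet> v)\<^sup>2)"
    unfolding abs_mult abs_power2 using bound by (intro sum_mono mult_right_mono) auto
  also have "\<dots> = C * (\<Sum>v\<in>V. (norm ((A - M) *v v))\<^sup>2)"
    by (simp add: 4 sum_distrib_left mult.assoc)
  finally show ?thesis .
qed

section \<open>The performance as a spectral sum\<close>

text \<open>Contribution of one eigenvalue \<open>x\<close> to the performance: the value in
  \<open>delay_integral\<close> divided by \<open>2 * pi\<close>. It vanishes at 0, in accordance
  with the zero mode being filtered out.\<close>

definition mode_cost :: "real \<Rightarrow> real \<Rightarrow> real" where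
  "mode_cost \<tau> x = x * cos (\<tau> * x) / (1 - sin (\<tau> * x)) / 2"

definition mode_cost' :: "real \<Rightarrow> real \<Rightarrow> real" where
  "mode_cost' \<tau> x = (\<tau> * x + cos (\<tau> * x)) / (1 - sin (\<tau> * x)) / 2"

text \<open>By \<open>sin^2 + cos^2 = 1\<close> the numerator of the quotient rule contains the
  factor \<open>1 - sin (\<tau> * x)\<close>, which cancels once against the squared
  denominator.\<close>

lemma mode_cost_has_derivative:
  assumes "sin (\<tau> * x) \<noteq> 1"
  shows "(mode_cost \<tau> has_real_derivative mode_cost' \<tau> x) (at x within S)"
proof -
  have "(mode_cost \<tau> has_real_derivative
     (((cos (\<tau> * x) - x * (\<tau> * sin (\<tau> * x))) * (1 - sin (\<tau> * x)) + x * cos (\<tau> * x) * (\<tau> * cos (\<tau> * x))) / (1 - sin (\<tau> * x))\<^sup>2 / 2)) (at x within S)"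
    unfolding mode_cost_def[abs_def] using assms
    by (intro DERIV_cdivide) (auto intro!: derivative_eq_intros simp: power2_eq_square algebra_simps)
  moreover have "(cos (\<tau> * x) - x * (\<tau> * sin (\<tau> * x))) * (1 - sin (\<tau> * x)) + x * cos (\<tau> * x) * (\<tau> * cos (\<tau> * x))
     = (\<tau> * x + cos (\<tau> * x)) * (1 - sin (\<tau> * x))"
    using sin_cos_squared_add[of "\<tau> * x"] by algebra
  ultimately show ?thesis using assms by (simp add: mode_cost'_def power2_eq_square)
qed

lemma mode_cost'_has_derivative:
  assumes "sin (\<tau> * x) \<noteq> 1"
  shows "(mode_cost' \<tau> has_real_derivative
     ((\<tau> - \<tau> * sin (\<tau> * x)) * (1 - sin (\<tau> * x)) + (\<tau> * x + cos (\<tau> * x)) * (\<tau> * cos (\<tau> * x))) / (1 - sin (\<tau> * x))\<^sup>2 / 2) (at x within S)"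
  unfolding mode_cost'_def[abs_def] using assms
  by (intro DERIV_cdivide) (auto intro!: derivative_eq_intros simp: power2_eq_square algebra_simps)

text \<open>The second derivative is continuous on the compact interval, hence bounded by some
  \<open>C\<close>, and \<open>mode_cost'\<close> is Lipschitz there. The mean value inequality for
  \<open>mode_cost\<close> minus its linear part at \<open>y\<close> then gives the quadratic
  remainder.\<close>

lemma mode_cost_first_order:
  assumes \<tau>: "0 \<le> \<tau>" and b: "\<tau> * b < pi / 2"
  obtains C where "\<And>x y. x \<in> {0..b} \<Longrightarrow> y \<in> {0..b} \<Longrightarrow>
    \<bar>mode_cost \<tau> x - mode_cost \<tau> y - mode_cost' \<tau> y * (x - y)\<bar> \<le> C * (x - y)\<^sup>2"
proof -
  define d where "d = (\<lambda>x. ((\<tau> - \<tau> * sin (\<tau> * x)) * (1 - sin (\<tau> * x)) + (\<tau> * x + cos (\<tau> * x)) * (\<tau> * cos (\<tau> * x))) / (1 - sin (\<tau> * x))\<^sup>2 / 2)"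
  have sin: "sin (\<tau> * x) \<noteq> 1" if "x \<in> {0..b}" for x
    using that \<tau> b mult_left_mono[of x b \<tau>] by (intro sin_neq_1) auto
  have "continuous_on {0..b} d" unfolding d_def
    using sin by (intro continuous_intros) auto
  hence "bounded (d ` {0..b})" by (intro compact_imp_bounded compact_continuous_image) auto
  then obtain C where "\<forall>x\<in>{0..b}. \<bar>d x\<bar> \<le> C"
    unfolding bounded_iff by auto
  hence C: "\<bar>d x\<bar> \<le> C" if "x \<in> {0..b}" for x using that by blast
  have deriv: "(mode_cost' \<tau> has_real_derivative d x) (at x within S)" if "x \<in> {0..b}" for x S
    unfolding d_def by (rule mode_cost'_has_derivative[OF sin[OF that]])
  have lip: "\<bar>mode_cost' \<tau> x - mode_cost' \<tau> y\<bar> \<le> C * \<bar>x - y\<bar>" if "x \<in> {0..b}" "y \<in> {0..b}" for x y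
  proof -
    have "norm (mode_cost' \<tau> x - mode_cost' \<tau> y) \<le> C * norm (x - y)"
      by (rule field_differentiable_bound[where S = "{0..b}" and f' = d])
         (use that C deriv in auto)
    thus ?thesis by simp
  qed
  show ?thesis
  proof (rule that[of C])
    fix x y assume xy: "x \<in> {0..b}" "y \<in> {0..b}"
    have seg: "z \<in> {0..b}" "\<bar>z - y\<bar> \<le> \<bar>x - y\<bar>" if "z \<in> closed_segment x y" for z
      using that xy by (auto simp: closed_segment_eq_real_ivl split: if_splits)
    define g where "g = (\<lambda>x. mode_cost \<tau> x - mode_cost' \<tau> y * x)"
    have "C \<ge> 0" using C[OF xy(1)] by simp
    have "norm (g x - g y) \<le> (C * \<bar>x - y\<bar>) * norm (x - y)"
    proof (rule field_differentiable_bound[where S = "closed_segment x y" and f' = "\<lambda>z. mode_cost' \<tau> z - mode_cost' \<tau> y"])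
      fix z assume z: "z \<in> closed_segment x y"
      show "(g has_real_derivative mode_cost' \<tau> z - mode_cost' \<tau> y) (at z within closed_segment x y)"
        unfolding g_def using sin[OF seg(1)[OF z]]
        by (auto intro!: derivative_eq_intros mode_cost_has_derivative)
      have "\<bar>mode_cost' \<tau> z - mode_cost' \<tau> y\<bar> \<le> C * \<bar>z - y\<bar>" by (rule lip) (use seg[OF z] xy in auto)
      also have "\<dots> \<le> C * \<bar>x - y\<bar>" using seg[OF z] \<open>C \<ge> 0\<close> by (intro mult_left_mono)
      finally show "norm (mode_cost' \<tau> z - mode_cost' \<tau> y) \<le> C * \<bar>x - y\<bar>" by simp
    qed auto
    also have "\<dots> = C * (x - y)\<^sup>2" by (simp add: power2_eq_square flip: abs_mult)
    finally show "\<bar>mode_cost \<tau> x - mode_cost \<tau> y - mode_cost' \<tau> y * (x - y)\<bar> \<le> C * (x - y)\<^sup>2"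
      by (simp add: g_def algebra_simps)
  qed
qed

lemma matrix_diff_rdistrib:
  fixes A B :: "'a::ring_1^'n::finite^'m" and C :: "'a^'k^'n"
  shows "(A - B) ** C = A ** C - B ** C"
  by (simp add: matrix_matrix_mult_def vec_eq_iff left_diff_distrib sum_subtractf)

lemma matrix_diff_ldistrib:
  fixes A :: "'a::ring_1^'n::finite^'m" and B C :: "'a^'k^'n"
  shows "A ** (B - C) = A ** B - A ** C"
  by (simp add: matrix_matrix_mult_def vec_eq_iff right_diff_distrib sum_subtractf)

section \<open>Diagonalisation of the transfer function\<close>

text \<open>Only vectors orthogonal to the constants carry weight, and the averaging matrix
  annihilates those.\<close>

lemma centering_mult_spec_mat:
  fixes g :: "real^'n::finite \<Rightarrow> 'a::real_field"
  assumes "\<And>v. v \<in> B \<Longrightarrow> g v = 0 \<or> v \<bullet> 1 = 0"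
  shows "centering ** spec_mat B g = spec_mat B g"
proof -
  have "(\<chi> a b. 1 / of_nat CARD('n)) ** spec_mat B g = (0 :: 'a^'n^'n)"
  proof -
    have "(\<Sum>k\<in>UNIV. 1 / of_nat CARD('n) * (\<Sum>v\<in>B. g v * of_real (v $ k * v $ b))) = 0" for b
    proof -
      have "(\<Sum>k\<in>UNIV. 1 / of_nat CARD('n) * (\<Sum>v\<in>B. g v * of_real (v $ k * v $ b)))
         = 1 / of_nat CARD('n) * (\<Sum>v\<in>B. \<Sum>k\<in>UNIV. g v * of_real (v $ k * v $ b))"
        by (subst sum.swap) (simp add: sum_distrib_left)
      also have "\<dots> = 1 / of_nat CARD('n) * (\<Sum>v\<in>B. g v * of_real (v \<bullet> 1) * of_real (v $ b))"
        by (simp add: inner_vec_def sum_distrib_left sum_distrib_right mult_ac)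
      also have "(\<Sum>v\<in>B. g v * of_real (v \<bullet> 1) * of_real (v $ b)) = 0"
        by (intro sum.neutral ballI) (use assms in fastforce)
      finally show ?thesis by simp
    qed
    thus ?thesis by (simp add: spec_mat_def matrix_matrix_mult_def vec_eq_iff)
  qed
  thus ?thesis by (simp add: centering_def matrix_diff_rdistrib)
qed

text \<open>The frequency 0 is excluded because the matrix to be inverted is then the singular
  \<open>L\<close>. Eigenvectors with nonzero eigenvalue are orthogonal to the constants by
  \<open>L 1 = 0\<close>, so centering changes nothing.\<close>

lemma transfer_spectral:
  assumes B: "eigenbasis L B \<mu>" and L1: "L *v 1 = 0" and \<tau>: "0 \<le> \<tau>"
    and \<mu>: "\<And>v. v \<in> B \<Longrightarrow> 0 \<le> \<mu> v \<and> \<tau> * \<mu> v < pi / 2" and \<omega>: "\<omega> \<noteq> 0"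
  shows "transfer L \<tau> (\<i> * of_real \<omega>) =
    spec_mat B (\<lambda>v. of_real (\<mu> v) / (\<i> * of_real \<omega> + exp (- of_real \<tau> * (\<i> * of_real \<omega>)) * of_real (\<mu> v)))"
proof -
  let ?s = "\<i> * of_real \<omega> :: complex"
  let ?z = "exp (- of_real \<tau> * ?s)"
  let ?d = "\<lambda>v. ?s + ?z * of_real (\<mu> v)"
  have d0: "?d v \<noteq> 0" if "v \<in> B" for v
    using delay_denominator_nonzero[OF \<tau>, of "\<mu> v" \<omega>] \<mu>[OF that] \<omega> by (cases "\<mu> v = 0") auto
  have L: "cmat L = spec_mat B (\<lambda>v. of_real (\<mu> v))"
    using cmat_spec_mat[of B \<mu>] spec_mat_eigenvalue[OF B] by simp
  have "mat ?s + mat ?z ** cmat L = spec_mat B ?d"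
    by (simp only: L mat_mult_spec_mat spec_mat_add mat_eq_spec_mat[OF B, of ?s])
  moreover have "spec_mat B ?d ** spec_mat B (\<lambda>v. 1 / ?d v) = mat 1"
    unfolding spec_mat_mult[OF B] spec_mat_1[OF B, symmetric] by (rule spec_mat_cong) (use d0 in simp)
  ultimately have inv: "matrix_inv (mat ?s + mat ?z ** cmat L) = spec_mat B (\<lambda>v. 1 / ?d v)"
    by (simp only: matrix_inv_eqI)
  have "v \<bullet> 1 = 0" if "v \<in> B" "\<mu> v \<noteq> 0" for v
    using eigenbasis_inner_mult[OF B that(1), of 1] that(2) L1 by simp
  hence "centering ** spec_mat B (\<lambda>v. of_real (\<mu> v) / ?d v) = spec_mat B (\<lambda>v. of_real (\<mu> v) / ?d v)"
    by (intro centering_mult_spec_mat) auto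
  thus ?thesis unfolding transfer_def inv
    by (simp add: L spec_mat_mult[OF B] flip: matrix_mul_assoc)
qed

text \<open>The trace is a sum of squared moduli, one per mode. Positive eigenvalues integrate by
  \<open>delay_integral\<close>, zero eigenvalues contribute 0, and the singular frequency 0 is
  negligible.\<close>

lemma rho_ss_spectral:
  assumes B: "eigenbasis L B \<mu>" and L1: "L *v 1 = 0" and \<tau>: "0 \<le> \<tau>"
    and \<mu>: "\<And>v. v \<in> B \<Longrightarrow> 0 \<le> \<mu> v \<and> \<tau> * \<mu> v < pi / 2"
  shows "rho_ss L \<tau> = (\<Sum>v\<in>B. mode_cost \<tau> (\<mu> v))"
proof -
  define h where "h = (\<lambda>\<omega> v. of_real (\<mu> v) / (\<i> * of_real \<omega> + exp (- of_real \<tau> * (\<i> * of_real \<omega>)) * of_real (\<mu> v)) :: complex)"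
  have sum: "((\<lambda>\<omega>. \<Sum>v\<in>B. (norm (h \<omega> v))\<^sup>2) has_integral (\<Sum>v\<in>B. 2 * pi * mode_cost \<tau> (\<mu> v))) UNIV"
  proof (rule has_integral_sum)
    show "finite B" using B by (simp add: eigenbasis_def)
    fix v assume v: "v \<in> B"
    show "((\<lambda>\<omega>. (norm (h \<omega> v))\<^sup>2) has_integral 2 * pi * mode_cost \<tau> (\<mu> v)) UNIV"
    proof (cases "\<mu> v = 0")
      case False
      hence "0 < \<mu> v" "\<tau> * \<mu> v < pi / 2" using \<mu>[OF v] by auto
      moreover have "2 * pi * (y / 2) = pi * y" for y :: real by simp
      ultimately show ?thesis unfolding h_def mode_cost_def
        using delay_integral[OF \<tau>, of "\<mu> v"] by (simp only:)
    qed (simp add: h_def mode_cost_def)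
  qed
  have integrand: "Re (trace (conj_transpose (transfer L \<tau> (\<i> * of_real \<omega>)) ** transfer L \<tau> (\<i> * of_real \<omega>)))
      = (\<Sum>v\<in>B. (norm (h \<omega> v))\<^sup>2)" if "\<omega> \<in> UNIV - {0}" for \<omega>
  proof -
    have "transfer L \<tau> (\<i> * of_real \<omega>) = spec_mat B (h \<omega>)"
      unfolding h_def by (rule transfer_spectral[OF B L1 \<tau> \<mu>]) (use that in auto)
    thus ?thesis by (simp only: trace_conj_transpose_spec_mat[OF B] Re_complex_of_real)
  qed
  have "((\<lambda>\<omega>. Re (trace (conj_transpose (transfer L \<tau> (\<i> * of_real \<omega>)) ** transfer L \<tau> (\<i> * of_real \<omega>))))
     has_integral (\<Sum>v\<in>B. 2 * pi * mode_cost \<tau> (\<mu> v))) UNIV"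
    by (rule has_integral_spike[OF negligible_sing[of 0] integrand sum])
  hence "rho_ss L \<tau> = 1 / (2 * pi) * (\<Sum>v\<in>B. 2 * pi * mode_cost \<tau> (\<mu> v))"
    unfolding rho_ss_def by (simp only: integral_unique)
  thus ?thesis by (simp flip: sum_distrib_left)
qed

section \<open>Laplacians and the sensitivity coefficient\<close>

lemma outer_mult_vec: "outer u v *v x = (v \<bullet> x) *\<^sub>R u"
  by (simp add: outer_def matrix_vector_mult_def vec_eq_iff inner_vec_def sum_distrib_left mult_ac)

lemma edge_vec_inner_1: "edge_vec i j \<bullet> 1 = 0"
  by (simp add: edge_vec_def inner_diff_left inner_axis')

lemma laplacian_mult_vec:
  "laplacian w *v x = (\<Sum>(i, j)\<in>graph_edges w. (w i j / 2 * (edge_vec i j \<bullet> x)) *\<^sub>R edge_vec i j)"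
proof -
  have "(\<Sum>e\<in>S. M e) *v x = (\<Sum>e\<in>S. M e *v x)" for S and M :: "'a \<times> 'a \<Rightarrow> real^'a^'a"
    by (induction S rule: infinite_finite_induct) (simp_all add: matrix_vector_mult_add_rdistrib)
  thus ?thesis
    by (simp add: laplacian_def scaleR_matrix_vector_assoc[symmetric] scaleR_sum_right case_prod_unfold outer_mult_vec)
qed

lemma laplacian_mult_1: "laplacian w *v 1 = 0"
  by (simp add: laplacian_mult_vec edge_vec_inner_1)

lemma transpose_laplacian: "transpose (laplacian w) = laplacian w"
proof -
  have "laplacian w $ a $ b = laplacian w $ b $ a" for a b
    by (simp add: laplacian_def outer_def case_prod_unfold mult.commute)
  thus ?thesis by (simp add: transpose_def vec_eq_iff)
qed

lemma laplacian_quadratic_form_nonneg: "0 \<le> x \<bullet> (laplacian w *v x)"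
proof -
  have "x \<bullet> (laplacian w *v x) = (\<Sum>(i, j)\<in>graph_edges w. w i j / 2 * (edge_vec i j \<bullet> x)\<^sup>2)"
    by (simp add: laplacian_mult_vec inner_sum_right case_prod_unfold power2_eq_square inner_commute mult.assoc)
  also have "\<dots> \<ge> 0" by (intro sum_nonneg) (auto simp: graph_edges_def)
  finally show ?thesis .
qed

text \<open>Positivity of \<open>t\<close> keeps the edge set fixed. The edge enters as
  \<open>(i, j)\<close> and as \<open>(j, i)\<close> with equal outer products, which absorbs the
  factor 1/2 in the Laplacian.\<close>

lemma laplacian_set_edge_weight:
  assumes w: "is_weighted_graph w" and e: "(i, j) \<in> graph_edges w" and t: "0 < t"
  shows "laplacian (set_edge_weight w i j t) = laplacian w + (t - w i j) *\<^sub>R outer (edge_vec i j) (edge_vec i j)"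
proof -
  define w' where "w' = set_edge_weight w i j t"
  define O' where "O' = (\<lambda>(a, b). outer (edge_vec a b) (edge_vec a b) :: real^'a^'a)"
  have sym: "w j i = w i j" and ij: "i \<noteq> j" "0 < w i j" using w e by (auto simp: is_weighted_graph_def graph_edges_def)
  have edges: "graph_edges w' = graph_edges w"
    using ij t sym by (auto simp: graph_edges_def w'_def set_edge_weight_def)
  have Osym: "O' (j, i) = O' (i, j)"
    by (simp add: O'_def outer_def edge_vec_def vec_eq_iff algebra_simps)
  have "laplacian w' - laplacian w = (1/2) *\<^sub>R (\<Sum>e\<in>graph_edges w. (w' (fst e) (snd e) - w (fst e) (snd e)) *\<^sub>R O' e)"
    by (simp add: laplacian_def edges O'_def case_prod_unfold scaleR_diff_left sum_subtractf scaleR_diff_right)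
  also have "(\<Sum>e\<in>graph_edges w. (w' (fst e) (snd e) - w (fst e) (snd e)) *\<^sub>R O' e)
     = (\<Sum>e\<in>{(i, j), (j, i)}. (w' (fst e) (snd e) - w (fst e) (snd e)) *\<^sub>R O' e)"
    by (rule sum.mono_neutral_right)
       (use ij sym in \<open>auto simp: graph_edges_def w'_def set_edge_weight_def\<close>)
  also have "\<dots> = (t - w i j) *\<^sub>R O' (i, j) + (t - w i j) *\<^sub>R O' (j, i)"
    using ij sym by (simp add: w'_def set_edge_weight_def)
  also have "\<dots> = 2 *\<^sub>R ((t - w i j) *\<^sub>R O' (i, j))" by (simp only: Osym scaleR_2)
  finally show ?thesis by (simp add: w'_def O'_def algebra_simps)
qed

section \<open>Matrix functions and the pseudo-inverse in an eigenbasis\<close>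

lemma spec_mat_eq_sum_outer: "spec_mat B g = (\<Sum>v\<in>B. g v *\<^sub>R outer v v)" for g :: "_ \<Rightarrow> real"
  by (simp add: spec_mat_def outer_def vec_eq_iff)

lemma sums_spec_mat:
  fixes h :: "nat \<Rightarrow> real^'n::finite \<Rightarrow> real"
  assumes "\<And>v. v \<in> B \<Longrightarrow> (\<lambda>k. h k v) sums g v"
  shows "(\<lambda>k. spec_mat B (h k)) sums spec_mat B g"
  unfolding spec_mat_eq_sum_outer using assms by (intro sums_sum sums_scaleR_left)

lemma mat_pow_spec_mat:
  assumes "eigenbasis L B \<mu>"
  shows "mat_pow (spec_mat B g) k = spec_mat B (\<lambda>v. g v ^ k)"
  by (induction k) (simp_all add: spec_mat_1[OF assms] spec_mat_mult[OF assms])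

lemma mat_cos_spec_mat:
  assumes "eigenbasis L B \<mu>"
  shows "mat_cos (spec_mat B g) = spec_mat B (\<lambda>v. cos (g v))"
  unfolding mat_cos_def mat_pow_spec_mat[OF assms] spec_mat_scaleR[symmetric]
  by (intro sums_unique[symmetric] sums_spec_mat cos_paired)

lemma mat_sin_spec_mat:
  assumes "eigenbasis L B \<mu>"
  shows "mat_sin (spec_mat B g) = spec_mat B (\<lambda>v. sin (g v))"
  unfolding mat_sin_def mat_pow_spec_mat[OF assms] spec_mat_scaleR[symmetric]
  by (intro sums_unique[symmetric] sums_spec_mat sin_paired)

text \<open>The definite description needs uniqueness: two solutions define the same projections
  \<open>A ** X = A ** Y\<close> and \<open>X ** A = Y ** A\<close>, whence
  \<open>X = X ** A ** X = Y ** A ** Y = Y\<close>.\<close>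

lemma pinv_eqI:
  assumes "A ** X ** A = A" "X ** A ** X = X" "transpose (A ** X) = A ** X" "transpose (X ** A) = X ** A"
  shows "pinv A = X"
  unfolding pinv_def
proof (rule the_equality)
  fix Y assume Y: "A ** Y ** A = A \<and> Y ** A ** Y = Y \<and> transpose (A ** Y) = A ** Y \<and> transpose (Y ** A) = Y ** A"
  have "A ** X = transpose (A ** X)" by (simp only: assms)
  also have "\<dots> = transpose ((A ** Y) ** (A ** X))" using Y by (simp add: matrix_mul_assoc)
  also have "\<dots> = (A ** X) ** (A ** Y)" using Y assms by (simp only: matrix_transpose_mul)
  also have "\<dots> = A ** Y" using assms by (simp add: matrix_mul_assoc)
  finally have AX: "A ** X = A ** Y" .
  have "X ** A = transpose (X ** A)" by (simp only: assms)
  also have "\<dots> = transpose ((X ** A) ** (Y ** A))" using Y by (simp flip: matrix_mul_assoc)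
  also have "\<dots> = (Y ** A) ** (X ** A)" using Y assms by (simp only: matrix_transpose_mul)
  also have "\<dots> = Y ** (A ** X ** A)" by (simp only: matrix_mul_assoc)
  also have "\<dots> = Y ** A" by (simp only: assms)
  finally have XA: "X ** A = Y ** A" .
  have "X = X ** A ** X" by (simp only: assms)
  also have "\<dots> = Y ** (A ** X)" by (simp only: XA matrix_mul_assoc)
  also have "\<dots> = Y" using Y by (simp only: AX matrix_mul_assoc)
  finally show "Y = X" by simp
qed (use assms in blast)

text \<open>With \<open>J\<close> the projection onto the constants, the matrix is
  \<open>T - J\<close> for an invertible \<open>T\<close> that fixes the constants. Its
  pseudo-inverse is the inverse \<open>S\<close> of \<open>T\<close> minus \<open>J\<close>, as both
  products equal the projection \<open>mat 1 - J\<close>; on vectors orthogonal to the constants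
  \<open>J\<close> drops out.\<close>

lemma pinv_centering_minus_spec_mat:
  fixes L :: "real^'n::finite^'n"
  assumes B: "eigenbasis L B \<mu>" and g1: "\<And>v. v \<in> B \<Longrightarrow> g v \<noteq> 1"
    and g0: "\<And>v. v \<in> B \<Longrightarrow> g v = 0 \<or> v \<bullet> 1 = 0" and x: "x \<bullet> 1 = 0"
  shows "pinv (centering - spec_mat B g) *v x = spec_mat B (\<lambda>v. 1 / (1 - g v)) *v x"
proof -
  define J :: "real^'n^'n" where "J = (\<chi> a b. 1 / of_nat CARD('n))"
  define T where "T = spec_mat B (\<lambda>v. 1 - g v)"
  define S where "S = spec_mat B (\<lambda>v. 1 / (1 - g v))"
  define A where "A = centering - spec_mat B g"
  have cen: "centering = mat 1 - J" by (simp add: centering_def J_def)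
  have T: "T = mat 1 - spec_mat B g" by (simp add: T_def spec_mat_diff spec_mat_1[OF B])
  have A: "A = T - J" by (simp add: A_def cen T)
  have TS: "T ** S = mat 1"
    unfolding T_def S_def spec_mat_mult[OF B] spec_mat_1[OF B, symmetric] by (rule spec_mat_cong) (use g1 in simp)
  hence ST: "S ** T = mat 1" using matrix_left_right_inverse by blast
  have "J ** spec_mat B g = 0"
    using centering_mult_spec_mat[of B g] g0 by (simp add: cen matrix_diff_rdistrib)
  hence JT: "J ** T = J" by (simp add: T matrix_diff_ldistrib)
  have trJ: "transpose J = J" by (simp add: J_def transpose_def vec_eq_iff)
  have trT: "transpose T = T" and trS: "transpose S = S" by (simp_all add: T_def S_def transpose_spec_mat)
  have TJ: "T ** J = J"
    using arg_cong[OF JT, of transpose] by (simp add: matrix_transpose_mul trJ trT)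
  have SJ: "S ** J = J"
    using arg_cong[OF TJ, of "\<lambda>M. S ** M"] by (simp add: matrix_mul_assoc ST)
  have JS: "J ** S = J"
    using arg_cong[OF SJ, of transpose] by (simp add: matrix_transpose_mul trJ trS)
  have JJ: "J ** J = J" by (simp add: J_def matrix_matrix_mult_def vec_eq_iff)
  have AX: "A ** (S - J) = mat 1 - J" "(S - J) ** A = mat 1 - J"
    by (simp_all add: A matrix_diff_rdistrib matrix_diff_ldistrib TS ST JT TJ SJ JS JJ)
  have "pinv A = S - J"
  proof (rule pinv_eqI)
    show "A ** (S - J) ** A = A" unfolding AX
      by (simp add: A matrix_diff_rdistrib matrix_diff_ldistrib JT JJ)
    show "(S - J) ** A ** (S - J) = S - J" unfolding AX
      by (simp add: matrix_diff_rdistrib matrix_diff_ldistrib JS JJ)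
    have "transpose (mat 1 - J) = mat 1 - J"
      using trJ by (simp add: transpose_def vec_eq_iff mat_def)
    thus "transpose (A ** (S - J)) = A ** (S - J)" "transpose ((S - J) ** A) = (S - J) ** A"
      by (simp_all only: AX)
  qed
  moreover have "J *v x = 0"
    using x by (simp add: J_def matrix_vector_mult_def vec_eq_iff inner_vec_def flip: sum_divide_distrib)
  ultimately show ?thesis
    by (simp add: A_def[symmetric] S_def[symmetric] matrix_vector_mult_diff_rdistrib)
qed

text \<open>For \<open>x\<close> orthogonal to the constants the pseudo-inverse acts as
  \<open>1 / (1 - sin)\<close>, so the matrix product acts as \<open>2 * mode_cost'\<close>. A basis
  vector either has eigenvalue 0, where the sine vanishes, or is orthogonal to the
  constants.\<close>

lemma sensitivity_formula_spectral:
  fixes L :: "real^'n::finite^'n"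
  assumes B: "eigenbasis L B \<mu>" and L1: "L *v 1 = 0" and x: "x \<bullet> 1 = 0"
    and sin: "\<And>v. v \<in> B \<Longrightarrow> sin (\<tau> * \<mu> v) \<noteq> 1"
  shows "(1/2) * (x \<bullet> (((\<tau> *\<^sub>R L + mat_cos (\<tau> *\<^sub>R L)) ** pinv (centering - mat_sin (\<tau> *\<^sub>R L))) *v x))
     = (\<Sum>v\<in>B. mode_cost' \<tau> (\<mu> v) * (v \<bullet> x)\<^sup>2)"
proof -
  have L: "\<tau> *\<^sub>R L = spec_mat B (\<lambda>v. \<tau> * \<mu> v)"
    by (simp add: spec_mat_scaleR spec_mat_eigenvalue[OF B])
  have "\<tau> *\<^sub>R L + mat_cos (\<tau> *\<^sub>R L) = spec_mat B (\<lambda>v. \<tau> * \<mu> v + cos (\<tau> * \<mu> v))"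
    unfolding L mat_cos_spec_mat[OF B] spec_mat_add ..
  moreover have "pinv (centering - mat_sin (\<tau> *\<^sub>R L)) *v x = spec_mat B (\<lambda>v. 1 / (1 - sin (\<tau> * \<mu> v))) *v x"
    unfolding L mat_sin_spec_mat[OF B]
  proof (rule pinv_centering_minus_spec_mat[OF B sin _ x])
    fix v assume v: "v \<in> B"
    show "sin (\<tau> * \<mu> v) = 0 \<or> v \<bullet> 1 = 0"
      using eigenbasis_inner_mult[OF B v, of 1] L1 by auto
  qed
  ultimately have "((\<tau> *\<^sub>R L + mat_cos (\<tau> *\<^sub>R L)) ** pinv (centering - mat_sin (\<tau> *\<^sub>R L))) *v x
     = spec_mat B (\<lambda>v. \<tau> * \<mu> v + cos (\<tau> * \<mu> v)) *v (spec_mat B (\<lambda>v. 1 / (1 - sin (\<tau> * \<mu> v))) *v x)"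
    by (simp flip: matrix_vector_mul_assoc)
  also have "\<dots> = spec_mat B (\<lambda>v. 2 * mode_cost' \<tau> (\<mu> v)) *v x"
  proof -
    have "y * (1 / d) = 2 * (y / d / 2)" for y d :: real by simp
    thus ?thesis by (simp only: matrix_vector_mul_assoc spec_mat_mult[OF B] mode_cost'_def)
  qed
  finally show ?thesis
    by (simp add: spec_mat_mult_vec inner_sum_right sum_distrib_left power2_eq_square inner_commute mult_ac)
qed

section \<open>Differentiation of the performance in one edge weight\<close>

lemma has_real_derivative_quadratic_bound:
  fixes f :: "real \<Rightarrow> real"
  assumes \<delta>: "0 < \<delta>" and bound: "\<And>t. \<bar>t - a\<bar> < \<delta> \<Longrightarrow> \<bar>f t - f a - D * (t - a)\<bar> \<le> K * (t - a)\<^sup>2"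
  shows "(f has_real_derivative D) (at a)"
proof -
  have "((\<lambda>t. (f t - f a) / (t - a) - D) \<longlongrightarrow> 0) (at a)"
  proof (rule Lim_null_comparison)
    show "\<forall>\<^sub>F t in at a. norm ((f t - f a) / (t - a) - D) \<le> K * \<bar>t - a\<bar>"
      unfolding eventually_at
    proof (intro exI[of _ \<delta>] conjI \<delta> ballI impI)
      fix t assume "t \<noteq> a \<and> dist t a < \<delta>"
      hence t: "\<bar>t - a\<bar> < \<delta>" "t - a \<noteq> 0" by (auto simp: dist_real_def)
      have "(f t - f a) / (t - a) - D = (f t - f a - D * (t - a)) / (t - a)"
        using t by (simp add: field_simps)
      hence "\<bar>(f t - f a) / (t - a) - D\<bar> = \<bar>f t - f a - D * (t - a)\<bar> / \<bar>t - a\<bar>"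
        by (simp only: abs_divide)
      also have "\<dots> \<le> K * (t - a)\<^sup>2 / \<bar>t - a\<bar>"
        by (intro divide_right_mono bound t) simp
      also have "\<dots> = K * (\<bar>t - a\<bar> * \<bar>t - a\<bar>) / \<bar>t - a\<bar>" by (simp add: power2_eq_square)
      also have "\<dots> = K * \<bar>t - a\<bar>" using t by (simp del: abs_mult_self_eq)
      finally show "norm ((f t - f a) / (t - a) - D) \<le> K * \<bar>t - a\<bar>" by simp
    qed
    show "((\<lambda>t. K * \<bar>t - a\<bar>) \<longlongrightarrow> 0) (at a)" by (auto intro!: tendsto_eq_intros)
  qed
  thus ?thesis unfolding has_field_derivative_iff by (simp add: Lim_null[symmetric])
qed

theorem theorem6:
  fixes w :: "'n::finite \<Rightarrow> 'n \<Rightarrow> real" and \<tau> :: real and i j :: 'n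
  assumes "is_weighted_graph w"
    and "graph_connected w"
    and "0 \<le> \<tau>"
    and "\<tau> * max_eigenvalue (laplacian w) < pi / 2"
    and "(i, j) \<in> graph_edges w"
  shows "((\<lambda>t. rho_ss (laplacian (set_edge_weight w i j t)) \<tau>) has_real_derivative
           (1/2) * (edge_vec i j \<bullet>
              (((\<tau> *\<^sub>R laplacian w + mat_cos (\<tau> *\<^sub>R laplacian w))
                 ** pinv (centering - mat_sin (\<tau> *\<^sub>R laplacian w))) *v edge_vec i j)))
         (at (w i j))"
proof -
  let ?L = "\<lambda>t. laplacian (set_edge_weight w i j t)"
  define E where "E = edge_vec i j"
  define m where "m = max_eigenvalue (laplacian w)"
  define q where "q = (norm E)\<^sup>2"
  define t0 where "t0 = w i j"
  \<comment> \<open>The first bound keeps the weight positive, hence the edge set fixed. The second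
    controls the largest eigenvalue, which grows by at most \<open>\<delta> * q\<close>; the added 1
    makes \<open>\<tau> * b < pi / 2\<close> strict and the denominator positive.\<close>
  define \<delta> where "\<delta> = min t0 ((pi / 2 - \<tau> * m) / (\<tau> * q + 1))"
  define b where "b = m + \<delta> * q"
  have t0: "0 < t0" using assms(5) by (simp add: t0_def graph_edges_def)
  have q: "0 \<le> q" by (simp add: q_def)
  have gap: "0 < pi / 2 - \<tau> * m" using assms(4) by (simp add: m_def)
  have den: "0 < \<tau> * q + 1" using assms(3) q by (intro add_nonneg_pos mult_nonneg_nonneg) auto
  have \<delta>: "0 < \<delta>" using t0 gap den by (simp add: \<delta>_def)
  have "\<delta> * (\<tau> * q + 1) \<le> pi / 2 - \<tau> * m"
    using den by (simp add: \<delta>_def pos_le_divide_eq[symmetric] del: divide_const_simps)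
  hence b: "\<tau> * b < pi / 2" using \<delta> by (simp add: b_def algebra_simps)
  have L: "?L t = laplacian w + (t - t0) *\<^sub>R outer E E" if "\<bar>t - t0\<bar> < \<delta>" for t
    unfolding E_def t0_def using that
    by (intro laplacian_set_edge_weight assms) (auto simp: \<delta>_def t0_def)
  \<comment> \<open>One compact window contains the spectra of all nearby Laplacians: below by
    nonnegativity of the quadratic form, above by the Rayleigh bound for \<open>w\<close> and
    Cauchy-Schwarz for the rank-one term.\<close>
  have range: "\<mu> v \<in> {0..b}" if "eigenbasis (?L t) B \<mu>" "v \<in> B" "\<bar>t - t0\<bar> < \<delta>" for t B \<mu> v
  proof -
    have v: "norm v = 1" using that by (simp add: eigenbasis_def)
    have \<mu>: "\<mu> v = v \<bullet> (?L t *v v)" by (rule eigenbasis_eigenvalue[OF that(1,2), symmetric])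
    also have "\<dots> = v \<bullet> (laplacian w *v v) + (t - t0) * (E \<bullet> v)\<^sup>2"
      unfolding L[OF that(3)]
      by (simp add: matrix_vector_mult_add_rdistrib outer_mult_vec inner_add_right power2_eq_square inner_commute
            flip: scaleR_matrix_vector_assoc)
    also have "\<dots> \<le> m * (norm v)\<^sup>2 + \<delta> * q"
    proof (intro add_mono mult_mono)
      show "v \<bullet> (laplacian w *v v) \<le> m * (norm v)\<^sup>2"
        unfolding m_def by (intro quadratic_form_le_max_eigenvalue transpose_laplacian)
      have "\<bar>E \<bullet> v\<bar> \<le> norm E" using Cauchy_Schwarz_ineq2[of E v] v by simp
      thus "(E \<bullet> v)\<^sup>2 \<le> q" unfolding q_def by (simp add: abs_le_square_iff[symmetric])
    qed (use that \<delta> in auto)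
    finally show ?thesis using laplacian_quadratic_form_nonneg[of v "set_edge_weight w i j t"] \<mu> v
      by (simp add: b_def)
  qed
  have rho: "rho_ss (?L t) \<tau> = (\<Sum>v\<in>B. mode_cost \<tau> (\<mu> v))" if "eigenbasis (?L t) B \<mu>" "\<bar>t - t0\<bar> < \<delta>" for t B \<mu>
  proof (rule rho_ss_spectral[OF that(1) laplacian_mult_1 assms(3)])
    fix v assume "v \<in> B"
    from range[OF that(1) this that(2)] have "0 \<le> \<mu> v" "\<mu> v \<le> b" by auto
    thus "0 \<le> \<mu> v \<and> \<tau> * \<mu> v < pi / 2" using mult_left_mono[of "\<mu> v" b \<tau>] assms(3) b by linarith
  qed
  have L0: "?L t0 = laplacian w" using L[of t0] \<delta> by simp
  obtain V \<beta> where V: "eigenbasis (?L t0) V \<beta>"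
    using symmetric_eigenbasis_exists[OF transpose_laplacian] .
  obtain C where C: "\<And>x y. x \<in> {0..b} \<Longrightarrow> y \<in> {0..b} \<Longrightarrow>
    \<bar>mode_cost \<tau> x - mode_cost \<tau> y - mode_cost' \<tau> y * (x - y)\<bar> \<le> C * (x - y)\<^sup>2"
    using mode_cost_first_order[OF assms(3) b] by blast
  \<comment> \<open>The quadratic form of \<open>mode_cost'\<close> of the Laplacian at
    \<open>E\<close>, written in the eigenbasis at the base point.\<close>
  define D where "D = (\<Sum>v\<in>V. mode_cost' \<tau> (\<beta> v) * (v \<bullet> E)\<^sup>2)"
  have "((\<lambda>t. rho_ss (?L t) \<tau>) has_real_derivative D) (at t0)"
  proof (rule has_real_derivative_quadratic_bound[OF \<delta>])
    fix t assume t: "\<bar>t - t0\<bar> < \<delta>"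
    obtain U \<alpha> where U: "eigenbasis (?L t) U \<alpha>"
      using symmetric_eigenbasis_exists[OF transpose_laplacian] .
    \<comment> \<open>The perturbation has rank one: its linear term sums to
      \<open>D * (t - t0)\<close>, and its squared Frobenius norm is
      \<open>(t - t0)^2 * q^2\<close>, which is the quadratic remainder.\<close>
    have diff: "(?L t - ?L t0) *v v = ((t - t0) * (v \<bullet> E)) *\<^sub>R E" for v
      unfolding L[OF t] L0 by (simp add: outer_mult_vec inner_commute flip: scaleR_matrix_vector_assoc)
    have "\<bar>(\<Sum>u\<in>U. mode_cost \<tau> (\<alpha> u)) - (\<Sum>v\<in>V. mode_cost \<tau> (\<beta> v))
        - (\<Sum>v\<in>V. mode_cost' \<tau> (\<beta> v) * (v \<bullet> ((?L t - ?L t0) *v v)))\<bar>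
      \<le> C * (\<Sum>v\<in>V. (norm ((?L t - ?L t0) *v v))\<^sup>2)"
      by (intro spectral_sum_first_order[OF U V] C range[OF U _ t] range[OF V]) (use \<delta> in auto)
    also have "(\<Sum>v\<in>V. mode_cost' \<tau> (\<beta> v) * (v \<bullet> ((?L t - ?L t0) *v v))) = D * (t - t0)"
      by (simp add: diff D_def sum_distrib_left power2_eq_square mult_ac)
    also have "(\<Sum>v\<in>V. (norm ((?L t - ?L t0) *v v))\<^sup>2) = (t - t0)\<^sup>2 * q * (\<Sum>v\<in>V. (v \<bullet> E)\<^sup>2)"
      by (simp add: diff q_def sum_distrib_left power_mult_distrib mult_ac)
    also have "(\<Sum>v\<in>V. (v \<bullet> E)\<^sup>2) = q" unfolding q_def by (rule eigenbasis_norm_squared[OF V])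
    finally show "\<bar>rho_ss (?L t) \<tau> - rho_ss (?L t0) \<tau> - D * (t - t0)\<bar> \<le> C * q\<^sup>2 * (t - t0)\<^sup>2"
      using rho[OF U t] rho[OF V] \<delta> by (simp add: power2_eq_square mult_ac)
  qed
  moreover have "(1/2) * (E \<bullet> (((\<tau> *\<^sub>R laplacian w + mat_cos (\<tau> *\<^sub>R laplacian w))
                 ** pinv (centering - mat_sin (\<tau> *\<^sub>R laplacian w))) *v E)) = D"
    unfolding D_def
  proof (rule sensitivity_formula_spectral[OF V[unfolded L0] laplacian_mult_1])
    fix v assume "v \<in> V"
    from range[OF V this] \<delta> have "0 \<le> \<beta> v" "\<beta> v \<le> b" by auto
    thus "sin (\<tau> * \<beta> v) \<noteq> 1"
      using mult_left_mono[of "\<beta> v" b \<tau>] assms(3) b by (intro sin_neq_1) auto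
  qed (simp add: E_def edge_vec_inner_1)
  ultimately show ?thesis by (simp only: E_def t0_def)
qed

end
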